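(* Let $k\geq 2$ be an integer and let $\chi_1,\chi_2$ be primitive non-trivial Dirichlet characters with conductors $q_1,q_2$ such that $\chi_1\chi_2(-1)=(-1)^k$. Let $\gamma=\begin{pmatrix} a & b\\ c & d\end{pmatrix}\in\Gamma_0(q_1q_2)$ with $c>0$. Then $$S_{\chi_1,\chi_2,k}(\gamma)=\sum_{j\bmod c}\ \sum_{n\bmod q_1}\overline{\chi_1}(n)\,\overline{\chi_2}(j)\,B_1\!\left(\frac{j}{c}\right)B_{k-1}\!\left(\frac{aj}{c}+\frac{n}{q_1}\right).$$
   Context: Notation: $e(z)=\exp(2\pi i z)$; for a Dirichlet character $\chi$ of conductor $q$, $\tau(\chi)=\sum_{n\bmod q}\chi(n)e(n/q)$ is its Gauss sum. For $\gamma=\begin{pmatrix} a&b\\ c&d\end{pmatrix}\in\Gamma_0(q_1q_2)$ write $\psi(\gamma)=\chi_1(d)\overline{\chi_2}(d)$. The Eisenstein series is defined for $z$ in the upper half plane $\mathcal H$ by $$E_{\chi_1,\chi_2,k}(z)=2\sum_{N\geq 1}\sum_{A\mid N}\chi_1(A)\overline{\chi_2}(N/A)(N/A)^{k-1}e(Nz);$$ it satisfies $E_{\chi_1,\chi_2,k}(\gamma z)=\psi(\gamma)(cz+d)^kE_{\chi_1,\chi_2,k}(z)$ for $\gamma\in\Gamma_0(q_1q_2)$. Let $P_{k-2}(z;X,Y)=(Xz+Y)^{k-2}$. For $\gamma\in\Gamma_0(q_1q_2)$ and $X,Y\in\mathbb C$, define the period integral $\phi_{\chi_1,\chi_2,k}(\gamma,X,Y)=\int_\infty^{\gamma\infty}E_{\chi_1,\chi_2,k}(z)P_{k-2}(z;X,Y)\,dz$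 (path in $\mathcal H$; convergent by exponential decay of $E$ at the cusps). For $\gamma$ with $c\neq 0$ define $S_{\chi_1,\chi_2,k}(\gamma)=(-1)^k\tau(\overline{\chi_1})(k-1)\,\phi_{\chi_1,\chi_2,k}(\gamma,1,-a/c)$. Periodic Bernoulli functions: for $m\geq 1$, $B_m(x)=\mathcal B_m(\{x\})$ for $x\in\mathbb R\setminus\mathbb Z$, where $\mathcal B_m$ is the $m$-th Bernoulli polynomial and $\{x\}$ the fractional part, and $B_m(x)=0$ for $x\in\mathbb Z$ (so $B_1(x)=\{x\}-1/2$ for non-integer $x$). *)

theory Defs
  imports "HOL-Analysis.Analysis"
begin

section \<open>Bernoulli numbers and polynomials (convention B_1 = -1/2)\<close>

function bernoulli_num :: "nat \<Rightarrow> real" where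
  "bernoulli_num 0 = 1"
| "bernoulli_num (Suc m) =
     - (1 / real (m + 2)) * (\<Sum>j\<le>m. real ((m + 2) choose j) * bernoulli_num j)"
  by pat_completeness auto
termination by (relation "Wellfounded.measure id") auto

definition bernoulli_poly :: "nat \<Rightarrow> real \<Rightarrow> real" where
  "bernoulli_poly m x = (\<Sum>j\<le>m. real (m choose j) * bernoulli_num j * x ^ (m - j))"

text \<open>Periodic Bernoulli function: B_m(x) = bernoulli_poly m (frac x) off the integers,
  and 0 at integers (convention of the paper).\<close>
definition periodic_bernoulli :: "nat \<Rightarrow> real \<Rightarrow> real" where
  "periodic_bernoulli m x = (if x \<in> \<int> then 0 else bernoulli_poly m (frac x))"

definition dirichlet_char :: "nat \<Rightarrow> (int \<Rightarrow> complex) \<Rightarrow> bool" where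
  "dirichlet_char q chi \<longleftrightarrow> q > 0 \<and>
     (\<forall>m n. chi (m * n) = chi m * chi n) \<and>
     (\<forall>n. chi (n + int q) = chi n) \<and>
     (\<forall>n. chi n \<noteq> 0 \<longleftrightarrow> coprime n (int q))"

definition primitive_dirichlet_char :: "nat \<Rightarrow> (int \<Rightarrow> complex) \<Rightarrow> bool" where
  "primitive_dirichlet_char q chi \<longleftrightarrow> dirichlet_char q chi \<and>
     (\<forall>d. d dvd q \<and> d < q \<longrightarrow>
        \<not> (\<forall>n. coprime n (int q) \<and> n mod int d = 1 mod int d \<longrightarrow> chi n = 1))"

definition nontrivial_dirichlet_char :: "nat \<Rightarrow> (int \<Rightarrow> complex) \<Rightarrow> bool" where
  "nontrivial_dirichlet_char q chi \<longleftrightarrow> (\<exists>n. coprime n (int q) \<and> chi n \<noteq> 1)"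

definition expi :: "complex \<Rightarrow> complex" where
  "expi z = exp (2 * of_real pi * \<i> * z)"

definition gauss_sum :: "nat \<Rightarrow> (int \<Rightarrow> complex) \<Rightarrow> complex" where
  "gauss_sum q chi = (\<Sum>n\<in>{0..<int q}. chi n * expi (of_int n / of_nat q))"

definition eisenstein_coeff :: "(int \<Rightarrow> complex) \<Rightarrow> (int \<Rightarrow> complex) \<Rightarrow> nat \<Rightarrow> nat \<Rightarrow> complex" where
  "eisenstein_coeff chi1 chi2 k N =
     (\<Sum>A\<in>{A. A dvd N}. chi1 (int A) * cnj (chi2 (int (N div A))) * of_nat (N div A) ^ (k - 1))"

definition eisenstein :: "(int \<Rightarrow> complex) \<Rightarrow> (int \<Rightarrow> complex) \<Rightarrow> nat \<Rightarrow> complex \<Rightarrow> complex" where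
  "eisenstein chi1 chi2 k z =
     2 * (\<Sum>N. eisenstein_coeff chi1 chi2 k (Suc N) * expi (of_nat (Suc N) * z))"

text \<open>The integral from \<infinity> to \<gamma>\<infinity> = a/c is taken along the vertical path
  z = a/c + i t, t from +\<infinity> down to 0 (dz = i dt).\<close>
definition period_integral ::
  "(int \<Rightarrow> complex) \<Rightarrow> (int \<Rightarrow> complex) \<Rightarrow> nat \<Rightarrow> int \<Rightarrow> int \<Rightarrow> int \<Rightarrow> int \<Rightarrow> complex \<Rightarrow> complex \<Rightarrow> complex" where
  "period_integral chi1 chi2 k a b c d X Y =
     - \<i> * integral {0<..} (\<lambda>t::real.
        eisenstein chi1 chi2 k (of_int a / of_int c + \<i> * of_real t) *
        (X * (of_int a / of_int c + \<i> * of_real t) + Y) ^ (k - 2))"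

definition S_sum ::
  "nat \<Rightarrow> (int \<Rightarrow> complex) \<Rightarrow> (int \<Rightarrow> complex) \<Rightarrow> nat \<Rightarrow> int \<Rightarrow> int \<Rightarrow> int \<Rightarrow> int \<Rightarrow> complex" where
  "S_sum q1 chi1 chi2 k a b c d =
     (-1) ^ k * gauss_sum q1 (\<lambda>n. cnj (chi1 n)) * of_nat (k - 1) *
     period_integral chi1 chi2 k a b c d 1 (- (of_int a / of_int c))"

end

(* On the vertical line above a/c the coefficient sum splits as a double series over A, B >= 1 of
   f A B * B^(k-1) * exp(-2 pi A B t), where f A B = chi1(A) * cnj(chi2(B)) * e(a A B / c) is periodic
   modulo c with mean zero in each variable.  Mean zero in B makes G_A(u) = sum_B f A B * exp(-B u)
   regular at u = 0, so the inner sum is, up to sign, the (k-1)st derivative of G_A at 2 pi A t, and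
   its moment integral reduces to G_A(0), a combination of values of B_1.  Mean zero in A makes the
   integrals over blocks of c consecutive A absolutely summable, so the integral can be taken
   termwise without invoking modularity.  Expanding chi1(A) by Gauss sums leaves the series
   sum_A e(A x) / A^(k-1), whose parity-symmetrized form is the Fourier series of B_(k-1). *)
theory Submission
  imports Defs "HOL-Complex_Analysis.Complex_Analysis" "HOL-Real_Asymp.Real_Asymp"
begin

section \<open>Dirichlet characters and sums over residues\<close>

text \<open>The critical weight is k = 2. There the L1 norm of the A-th term is of order 1/A, so sum
  and integral cannot be exchanged one A at a time. Grouping c consecutive A turns values of a
  derivative into differences, and each difference brings one more derivative and hence one more
  power of A in the denominator; all weights are then handled alike. The two means vanish for
  arithmetic reasons. Since q1 q2 divides c and a is prime to c, the character B -> e(a A B / c) is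
  not periodic modulo q2 when chi1(A) is nonzero, so its sum against cnj(chi2) over a period is 0;
  the same holds with the roles exchanged. Similar divisibility keeps a j / c + n / q1 off the
  integers when chi2(j) is nonzero, which gives convergence of the final series even for k = 2. On
  the vertical line (z - a/c)^(k-2) is (i t)^(k-2): a moment of order k - 2 against a derivative of
  order k - 1, so integration by parts leaves only the boundary value at 0.\<close>

lemma periodic_add_multiple:
  fixes h :: "int \<Rightarrow> 'a"
  assumes "\<And>n. h (n + c) = h n"
  shows "h (n + k * c) = h n"
proof (induction k rule: int_induct[where k = 0])
  case (step1 i)
  then show ?case using assms[of "n + i * c"] by (simp add: algebra_simps)
next
  case (step2 i)
  then show ?case using assms[of "n + (i - 1) * c"] by (simp add: algebra_simps)
qed simp

lemma periodic_cong:
  fixes h :: "int \<Rightarrow> 'a"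
  assumes "\<And>n. h (n + c) = h n" and "c dvd m - n"
  shows "h m = h n"
proof -
  obtain k where "m = n + k * c" using assms(2) by (auto simp: dvd_def algebra_simps)
  then show ?thesis using periodic_add_multiple[of h c n k] assms(1) by simp
qed

text \<open>A map injective modulo \<open>c\<close> permutes the finite set of residues.
  Translation, negation and multiplication by a unit are the instances below.\<close>

lemma sum_reindex_residues:
  fixes h :: "int \<Rightarrow> 'a::comm_monoid_add" and \<phi> :: "int \<Rightarrow> int"
  assumes per: "\<And>n. h (n + c) = h n" and c: "c > 0"
    and inj: "\<And>m n. c dvd \<phi> m - \<phi> n \<Longrightarrow> c dvd m - n"
  shows "(\<Sum>n\<in>{0..<c}. h (\<phi> n)) = sum h {0..<c}"
proof -
  let ?\<psi> = "\<lambda>n. \<phi> n mod c"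
  have "inj_on ?\<psi> {0..<c}"
  proof (rule inj_onI)
    fix m n assume mn: "m \<in> {0..<c}" "n \<in> {0..<c}" and "\<phi> m mod c = \<phi> n mod c"
    then have "c dvd m - n" by (auto simp: mod_eq_dvd_iff dest: inj)
    then have "m mod c = n mod c" by (simp add: mod_eq_dvd_iff)
    with mn show "m = n" by simp
  qed
  moreover have "?\<psi> ` {0..<c} \<subseteq> {0..<c}" using c by auto
  ultimately have "bij_betw ?\<psi> {0..<c} {0..<c}"
    by (simp add: bij_betw_def endo_inj_surj)
  then have "sum h {0..<c} = (\<Sum>n\<in>{0..<c}. h (?\<psi> n))" by (rule sum.reindex_bij_betw[symmetric])
  also have "\<dots> = (\<Sum>n\<in>{0..<c}. h (\<phi> n))"
  proof (intro sum.cong refl)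
    show "h (\<phi> n mod c) = h (\<phi> n)" for n
      by (rule periodic_cong[of h c, OF per]) (simp add: mod_eq_dvd_iff[symmetric])
  qed
  finally show ?thesis ..
qed

lemma sum_residues_shift:
  fixes h :: "int \<Rightarrow> 'a::comm_monoid_add"
  assumes "\<And>n. h (n + c) = h n" and "c > 0"
  shows "(\<Sum>n\<in>{0..<c}. h (n + t)) = sum h {0..<c}"
  using assms by (intro sum_reindex_residues) auto

lemma sum_residues_uminus:
  fixes h :: "int \<Rightarrow> 'a::comm_monoid_add"
  assumes "\<And>n. h (n + c) = h n" and "c > 0"
  shows "(\<Sum>n\<in>{0..<c}. h (- n)) = sum h {0..<c}"
proof (intro sum_reindex_residues assms)
  show "c dvd m - n" if "c dvd - m - - n" for m n
    using that by (metis dvd_minus_iff minus_diff_eq minus_diff_minus)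
qed

lemma sum_residues_mult:
  fixes h :: "int \<Rightarrow> 'a::comm_monoid_add"
  assumes "\<And>n. h (n + c) = h n" and "c > 0" and "coprime u c"
  shows "(\<Sum>n\<in>{0..<c}. h (u * n)) = sum h {0..<c}"
proof (intro sum_reindex_residues assms)
  show "c dvd m - n" if "c dvd u * m - u * n" for m n
    using that assms(3) by (metis coprime_commute coprime_dvd_mult_right_iff right_diff_distrib)
qed

section \<open>The additive character e(z)\<close>

lemma expi_add: "expi (x + y) = expi x * expi y"
  by (simp add: expi_def ring_distribs exp_add)

lemma expi_of_int [simp]: "expi (of_int n) = 1"
proof -
  have "2 * of_real pi * \<i> * of_int n = of_int (2 * n) * (of_real pi * \<i>)" by simp
  then show ?thesis unfolding expi_def using exp_integer_2pi[of "of_int n"]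
    by (simp add: algebra_simps)
qed

lemma expi_add_of_int [simp]: "expi (z + of_int n) = expi z"
  by (simp add: expi_add)

lemma norm_expi_of_real [simp]: "norm (expi (of_real x)) = 1"
  by (simp add: expi_def)

lemma norm_expi_frac [simp]: "norm (expi (of_int a / of_int b)) = 1"
  using norm_expi_of_real[of "of_int a / of_int b"] by simp

lemma expi_power: "expi z ^ n = expi (of_nat n * z)"
  by (simp add: expi_def exp_of_nat_mult[symmetric] algebra_simps)

lemma expi_of_real_eq_1_iff: "expi (of_real x) = 1 \<longleftrightarrow> x \<in> \<int>"
proof -
  have "expi (of_real x) = 1 \<longleftrightarrow> (\<exists>n. 2 * pi * x = of_int (2 * n) * pi)"
    unfolding expi_def by (subst exp_eq_1) simp
  also have "\<dots> \<longleftrightarrow> (\<exists>n::int. x = of_int n)" by (simp add: mult.commute)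
  finally show ?thesis by (auto elim: Ints_cases)
qed

lemma expi_frac_eq_1_imp_dvd:
  assumes "expi (of_int m / of_int c) = 1" "c \<noteq> 0"
  shows "c dvd m"
proof -
  have "real_of_int m / real_of_int c \<in> \<int>"
    using assms(1) expi_of_real_eq_1_iff[of "real_of_int m / real_of_int c"] by simp
  then obtain n where "real_of_int m / real_of_int c = of_int n" by (auto elim: Ints_cases)
  then have "real_of_int m = of_int (n * c)" using assms(2) by (simp add: field_simps)
  then show ?thesis by (simp only: of_int_eq_iff) simp
qed

section \<open>Dirichlet characters and twisted character sums\<close>

lemma dirichlet_charD:
  assumes "dirichlet_char q chi"
  shows "q > 0" "chi (m * n) = chi m * chi n" "chi (n + int q) = chi n"
    "chi n \<noteq> 0 \<longleftrightarrow> coprime n (int q)" 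
  using assms by (auto simp: dirichlet_char_def)

lemma dirichlet_char_cnj:
  "dirichlet_char q chi \<Longrightarrow> dirichlet_char q (\<lambda>n. cnj (chi n))"
  by (auto simp: dirichlet_char_def)

lemma dirichlet_char_1: 
  assumes "dirichlet_char q chi" shows "chi 1 = 1"
  using dirichlet_charD(2)[OF assms, of 1 1] dirichlet_charD(4)[OF assms, of 1] by simp

text \<open>Multiplication by a unit permutes the residues, so multiplying the positive sum of all
  \<open>norm (chi n)\<close> by \<open>norm (chi u)\<close> leaves it unchanged.\<close>

lemma dirichlet_char_norm:
  assumes "dirichlet_char q chi" "coprime u (int q)"
  shows "norm (chi u) = 1"
proof -
  note chi = dirichlet_charD[OF assms(1)]
  let ?S = "\<Sum>n\<in>{0..<int q}. norm (chi n)"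
  have "norm (chi u) * ?S = (\<Sum>n\<in>{0..<int q}. norm (chi (u * n)))"
    by (simp add: sum_distrib_left chi norm_mult)
  also have "\<dots> = ?S"
    using chi assms(2) by (intro sum_residues_mult) auto
  finally have *: "norm (chi u) * ?S = ?S" .
  \<comment> \<open>For \<open>q = 1\<close> the residue of 1 is represented by 0 in the summation
    range, hence the reduction modulo \<open>q\<close>.\<close>
  have "norm (chi (1 mod int q)) \<noteq> 0"
    using chi(1) by (simp add: chi(4))
  moreover have "1 mod int q \<in> {0..<int q}" using chi(1) by simp
  ultimately have "?S \<noteq> 0"
    by (subst sum_nonneg_eq_0_iff) auto
  with * show ?thesis by simp
qed

lemma dirichlet_char_norm_le: "dirichlet_char q chi \<Longrightarrow> norm (chi u) \<le> 1"
  using dirichlet_char_norm[of q chi u] dirichlet_charD(4)[of q chi u] by (cases "chi u = 0") auto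

text \<open>Modulo 1 every integer is congruent to 1, so a character takes only the value 1. A
  modulus above 1 is the form in which non-triviality enters: it gives \<open>chi 0 = 0\<close> and
  the divisibility contradictions at the cusp.\<close>

lemma nontrivial_dirichlet_char_modulus:
  assumes "dirichlet_char q chi" "nontrivial_dirichlet_char q chi"
  shows "q > 1"
proof (rule ccontr)
  assume "\<not> q > 1"
  then have "q = 1" using dirichlet_charD(1)[OF assms(1)] by simp
  obtain n where "chi n \<noteq> 1" using assms(2) by (auto simp: nontrivial_dirichlet_char_def)
  moreover have "chi n = chi 1"
    using \<open>q = 1\<close> by (intro periodic_cong[of chi "int q", OF dirichlet_charD(3)[OF assms(1)]]) auto
  ultimately show False using dirichlet_char_1[OF assms(1)] by simp
qed

lemma dirichlet_char_0: "dirichlet_char q chi \<Longrightarrow> q > 1 \<Longrightarrow> chi 0 = 0"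
  using dirichlet_charD(4)[of q chi 0] by auto

text \<open>If \<open>A\<close> shares a factor with \<open>q\<close>, primitivity yields a unit \<open>u\<close> with
  \<open>chi u \<noteq> 1\<close> and \<open>A u \<equiv> A\<close> modulo \<open>q\<close>, so that replacing \<open>n\<close> by \<open>u n\<close> forces the
  twisted sum to vanish.\<close>
lemma gauss_sum_twist:
  assumes "primitive_dirichlet_char q chi"
  shows "(\<Sum>n\<in>{0..<int q}. cnj (chi n) * expi (of_int (A * n) / of_nat q)) =
    chi A * gauss_sum q (\<lambda>n. cnj (chi n))"
proof -
  have dc: "dirichlet_char q chi" using assms by (simp add: primitive_dirichlet_char_def)
  note chi = dirichlet_charD[OF dc]
  define h where "h = (\<lambda>B n. cnj (chi n) * expi (of_int (B * n) / of_nat q))"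
  have e_cong: "expi (of_int m / of_nat q) = expi (of_int n / of_nat q)" if dvd: "int q dvd m - n" for m n
  proof -
    obtain k where "m - n = int q * k" using dvd by (elim dvdE)
    then have "m = n + int q * k" by simp
    then have "of_int m / of_nat q = of_int n / of_nat q + (of_int k :: complex)"
      using chi(1) by (simp add: field_simps)
    then show ?thesis by (simp only: expi_add_of_int)
  qed
  have per: "h B (n + int q) = h B n" for B n
    using e_cong[of "B * (n + int q)" "B * n"] by (simp add: h_def chi(3) algebra_simps)
  have mult: "(\<Sum>n\<in>{0..<int q}. h B (u * n)) = sum (h B) {0..<int q}" if "coprime u (int q)" for B u
    using that chi(1) per by (intro sum_residues_mult) auto
  show ?thesis
  proof (cases "coprime A (int q)")
    case True
    have "cnj (chi A) * sum (h A) {0..<int q} = (\<Sum>n\<in>{0..<int q}. h 1 (A * n))"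
      by (simp add: sum_distrib_left h_def chi(2) mult_ac)
    also have "\<dots> = gauss_sum q (\<lambda>n. cnj (chi n))"
      using mult[OF True, of 1] by (simp add: gauss_sum_def h_def)
    finally have "chi A * cnj (chi A) * sum (h A) {0..<int q} = chi A * gauss_sum q (\<lambda>n. cnj (chi n))"
      by simp
    moreover have "chi A * cnj (chi A) = 1"
      using dirichlet_char_norm[OF dc True] by (simp add: complex_norm_square[symmetric])
    ultimately show ?thesis by (simp add: h_def)
  next
    case False
    define g where "g = nat (gcd A (int q))"
    have "int g = gcd A (int q)" by (simp add: g_def)
    then have g: "int g dvd A" "g dvd q" by (auto simp flip: int_dvd_int_iff)
    have "g \<noteq> 0" using chi(1) g(2) by (metis dvd_0_left_iff not_gr0)
    have "g \<noteq> 1" using False \<open>int g = _\<close> coprime_iff_gcd_eq_1 by auto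
    \<comment> \<open>Primitivity is applied to the proper divisor \<open>q div g\<close>: a unit
      congruent to 1 modulo it fixes \<open>A\<close> modulo \<open>q\<close>, because
      \<open>g\<close> divides \<open>A\<close>.\<close>
    have "q div g < q" using \<open>g \<noteq> 0\<close> \<open>g \<noteq> 1\<close> chi(1) by simp
    moreover have "q div g dvd q" using g(2) by auto
    ultimately obtain u where u: "coprime u (int q)" "u mod int (q div g) = 1 mod int (q div g)"
      "chi u \<noteq> 1"
      using assms unfolding primitive_dirichlet_char_def by blast
    have "int g * int (q div g) dvd A * (u - 1)"
      using g(1) u(2) by (intro mult_dvd_mono) (auto simp: mod_eq_dvd_iff)
    moreover have "int g * int (q div g) = int q" using g(2) by (metis dvd_mult_div_cancel of_nat_mult)
    ultimately have dvd: "int q dvd A * (u - 1)" by simp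
    have "int q dvd A * (u * n) - A * n" for n
      using dvd_mult2[OF dvd, of n] by (simp add: algebra_simps)
    then have "h A (u * n) = cnj (chi u) * h A n" for n
      using e_cong[of "A * (u * n)" "A * n"] by (simp add: h_def chi(2))
    then have "cnj (chi u) * sum (h A) {0..<int q} = sum (h A) {0..<int q}"
      using mult[OF u(1), of A] by (simp add: sum_distrib_left)
    then have "sum (h A) {0..<int q} = 0" using u(3) by (metis complex_cnj_one_iff mult_cancel_right1)
    moreover have "chi A = 0" using False chi(4) by blast
    ultimately show ?thesis by (simp add: h_def)
  qed
qed

text \<open>Shifting the summation variable by \<open>q\<close> multiplies the sum by a root of unity other
  than 1.\<close>
lemma char_sum_twist_zero:
  assumes "dirichlet_char q chi" and "int q dvd c" and "c > 0" and "\<not> c dvd t * int q"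
  shows "(\<Sum>s\<in>{0..<c}. chi s * expi (of_int (t * s) / of_int c)) = 0"
proof -
  note chi = dirichlet_charD[OF assms(1)]
  define h where "h = (\<lambda>s. chi s * expi (of_int (t * s) / of_int c))"
  obtain l where l: "c = l * int q" using assms(2) by (auto simp: dvd_def mult.commute)
  have *: "h (s + int q) = expi (of_int (t * int q) / of_int c) * h s" for s
    by (simp add: h_def chi(3) ring_distribs add_divide_distrib expi_add)
  have "h (s + c) = h s" for s
  proof -
    have "chi (s + c) = chi s" using periodic_add_multiple[of chi "int q" s l] chi(3) l by simp
    moreover have "of_int (t * (s + c)) / of_int c = of_int (t * s) / of_int c + (of_int t :: complex)"
      using assms(3) by (simp add: field_simps)
    ultimately show ?thesis unfolding h_def by (simp only: expi_add_of_int)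
  qed
  then have "sum h {0..<c} = (\<Sum>s\<in>{0..<c}. h (s + int q))"
    using assms(3) by (intro sum_residues_shift[symmetric]) auto
  also have "\<dots> = expi (of_int (t * int q) / of_int c) * sum h {0..<c}"
    by (simp add: * sum_distrib_left)
  finally have "sum h {0..<c} = 0 \<or> expi (of_int (t * int q) / of_int c) = 1" by auto
  then show ?thesis
    using expi_frac_eq_1_imp_dvd[of "t * int q" c] assms(3,4) unfolding h_def by auto
qed

section \<open>Fourier expansion of Bernoulli polynomials\<close>

lemma summable_inverse_square: "summable (\<lambda>n. 1 / real (Suc n) ^ 2)"
  using inverse_power_summable[of 2, where ?'a = real] by (subst summable_Suc_iff) (simp add: field_simps)

text \<open>Multiplying by \<open>1 - w\<close> turns the logarithmic series into one that converges absolutely on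
  the closed disc.\<close>
lemma log_series_partial_sum:
  fixes w :: complex
  shows "(1 - w) * (\<Sum>A<Suc N. w ^ Suc A / of_nat (Suc A)) =
    w - (\<Sum>A<N. w ^ (A + 2) / of_nat ((A + 1) * (A + 2))) - w ^ (N + 2) / of_nat (Suc N)"
proof (induction N)
  case (Suc N)
  have nz: "of_nat (Suc N) \<noteq> (0 :: complex)" "of_nat (Suc (Suc N)) \<noteq> (0 :: complex)"
    by (simp_all only: of_nat_eq_0_iff)
  have "w ^ (N + 2) / of_nat (Suc N) =
      (w ^ (N + 2) / of_nat ((N + 1) * (N + 2)) + w ^ (N + 2) / of_nat (Suc (Suc N)) :: complex)"
  proof -
    have "1 / of_nat (Suc N) = 1 / (of_nat (Suc N) * of_nat (Suc (Suc N))) + 1 / (of_nat (Suc (Suc N)) :: complex)"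
    proof -
      have "1 / y = 1 / (y * z) + 1 / z" if "z = y + 1" "y \<noteq> 0" "z \<noteq> 0" for y z :: complex
        using that(2,3) unfolding that(1) by (simp add: divide_simps)
      from this[OF _ nz] show ?thesis by simp
    qed
    then show ?thesis
      by (metis (no_types, lifting) Suc_eq_plus1 add_2_eq_Suc' distrib_left of_nat_mult times_divide_eq_right mult.right_neutral)
  qed
  note split = this
  have "(1 - w) * (\<Sum>A<Suc (Suc N). w ^ Suc A / of_nat (Suc A)) =
      (1 - w) * (\<Sum>A<Suc N. w ^ Suc A / of_nat (Suc A)) +
      (w ^ (N + 2) / of_nat (Suc (Suc N)) - w ^ (Suc N + 2) / of_nat (Suc (Suc N)))"
    unfolding sum.lessThan_Suc[of _ "Suc N"] by (simp add: left_diff_distrib diff_divide_distrib distrib_left)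
  also have "\<dots> = w - (\<Sum>A<N. w ^ (A + 2) / of_nat ((A + 1) * (A + 2))) -
      (w ^ (N + 2) / of_nat ((N + 1) * (N + 2)) + w ^ (N + 2) / of_nat (Suc (Suc N))) +
      (w ^ (N + 2) / of_nat (Suc (Suc N)) - w ^ (Suc N + 2) / of_nat (Suc (Suc N)))"
    by (simp only: Suc.IH split)
  also have "\<dots> = w - (\<Sum>A<Suc N. w ^ (A + 2) / of_nat ((A + 1) * (A + 2))) -
      w ^ (Suc N + 2) / of_nat (Suc (Suc N))"
  proof -
    have "x - t - (p + q) + (q - r) = x - (t + p) - r" for x t p q r :: complex by simp
    then show ?thesis unfolding sum.lessThan_Suc[of _ N] .
  qed
  finally show ?case .
qed (simp add: algebra_simps power2_eq_square)

text \<open>On the unit circle the logarithmic series has no summable majorant. The accelerated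
  series \<open>T\<close> has one on the closed disc; its identity with the logarithm is known
  inside the disc and passes to the circle by radial limits, as in Abel's theorem. Division by
  \<open>1 - w\<close> is harmless where its norm is at least \<epsilon>.\<close>

lemma log_series_uniform_limit:
  fixes \<epsilon> :: real
  defines "S \<equiv> {w::complex. norm w \<le> 1 \<and> \<epsilon> \<le> norm (1 - w)}"
  assumes "\<epsilon> > 0"
  shows "uniform_limit S (\<lambda>N w. \<Sum>A<N. w ^ Suc A / of_nat (Suc A)) (\<lambda>w. - Ln (1 - w)) sequentially"
proof -
  define T where "T = (\<lambda>w::complex. \<Sum>A. w ^ (A + 2) / of_nat ((A + 1) * (A + 2)))"
  let ?D = "cball 0 1 :: complex set"
  have T: "uniform_limit ?D (\<lambda>N w. \<Sum>A<N. w ^ (A + 2) / of_nat ((A + 1) * (A + 2))) T sequentially"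
    unfolding T_def
  proof (rule Weierstrass_m_test[OF _ summable_inverse_square])
    fix n and w :: complex assume "w \<in> ?D"
    then have "norm w ^ (n + 2) \<le> 1" by (intro power_le_one) auto
    moreover have "real (Suc n) ^ 2 \<le> real ((n + 1) * (n + 2))" by (simp add: power2_eq_square algebra_simps)
    ultimately have "norm w ^ (n + 2) / real ((n + 1) * (n + 2)) \<le> 1 / real (Suc n) ^ 2"
      by (intro frac_le) auto
    then show "norm (w ^ (n + 2) / of_nat ((n + 1) * (n + 2))) \<le> 1 / real (Suc n) ^ 2"
      by (simp only: norm_divide norm_power norm_of_nat)
  qed
  have R: "uniform_limit ?D (\<lambda>N w. w ^ (N + 2) / of_nat (Suc N)) (\<lambda>_. 0) sequentially"
  proof (rule uniform_limitI)
    fix e :: real assume "e > 0"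
    have "(\<lambda>n. 1 / real (Suc n)) \<longlonglongrightarrow> 0" by (rule lim_1_over_n[THEN LIMSEQ_Suc])
    from order_tendstoD(2)[OF this \<open>e > 0\<close>]
    show "\<forall>\<^sub>F n in sequentially. \<forall>w\<in>?D. dist (w ^ (n + 2) / of_nat (Suc n)) 0 < e"
    proof (eventually_elim, intro ballI)
      fix n and w :: complex assume n: "1 / real (Suc n) < e" and "w \<in> ?D"
      then have "norm w ^ (n + 2) \<le> 1" by (intro power_le_one) auto
      then have "norm w ^ (n + 2) / real (Suc n) \<le> 1 / real (Suc n)"
        by (intro divide_right_mono) auto
      then show "dist (w ^ (n + 2) / of_nat (Suc n)) 0 < e"
        unfolding dist_norm using n by (simp only: norm_divide norm_power norm_of_nat diff_zero)
    qed
  qed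
  have contT: "continuous_on ?D T"
    by (rule uniform_limit_theorem[OF _ T])
      (intro always_eventually allI continuous_intros, simp_all only: of_nat_eq_0_iff, simp_all)
  have lim: "uniform_limit ?D (\<lambda>N w. (1 - w) * (\<Sum>A<Suc N. w ^ Suc A / of_nat (Suc A)))
      (\<lambda>w. w - T w) sequentially"
    unfolding log_series_partial_sum
    using uniform_limit_minus[OF uniform_limit_minus[OF uniform_limit_const T] R] by simp
  have eq_ball: "w - T w = - (1 - w) * Ln (1 - w)" if "norm w < 1" for w
  proof -
    have "(\<lambda>n. - (w ^ n) / of_nat n) sums ln (1 - w)"
      using Ln_series'[of "- w"] that by simp
    then have "(\<lambda>n. w ^ n / of_nat n) sums - ln (1 - w)"
      using sums_minus by fastforce
    then have "(\<lambda>n. w ^ Suc n / of_nat (Suc n)) sums - ln (1 - w)"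
      by (subst sums_Suc_iff) simp
    then have "(\<lambda>N. (1 - w) * (\<Sum>A<Suc N. w ^ Suc A / of_nat (Suc A))) \<longlonglongrightarrow> (1 - w) * (- ln (1 - w))"
      unfolding sums_def by (intro tendsto_intros LIMSEQ_Suc)
    moreover have "(\<lambda>N. (1 - w) * (\<Sum>A<Suc N. w ^ Suc A / of_nat (Suc A))) \<longlonglongrightarrow> w - T w"
      using lim that by (intro tendsto_uniform_limitI) auto
    ultimately have "(1 - w) * (- ln (1 - w)) = w - T w" by (rule LIMSEQ_unique)
    from this[symmetric] show ?thesis by (simp only: mult_minus_left mult_minus_right)
  qed
  have eq: "w - T w = - (1 - w) * Ln (1 - w)" if w: "norm w \<le> 1" "w \<noteq> 1" for w
  proof -
    let ?r = "\<lambda>n. of_real (1 - inverse (real (Suc n))) * w"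
    have "(\<lambda>n. of_real (1 - inverse (real (Suc n))) * w) \<longlonglongrightarrow> of_real (1 - 0) * w"
      by (intro tendsto_intros LIMSEQ_inverse_real_of_nat)
    then have r: "?r \<longlonglongrightarrow> w" by simp
    have norm_r: "norm (?r n) < 1" for n
    proof -
      have "\<bar>1 - inverse (real (Suc n))\<bar> < 1" by (simp add: field_simps)
      then have "\<bar>1 - inverse (real (Suc n))\<bar> * norm w < 1"
        using w(1) by (meson abs_ge_zero le_less_trans mult_left_le)
      then show ?thesis by (simp only: norm_mult norm_of_real)
    qed
    \<comment> \<open>This keeps the limit point off the branch cut, so that \<open>Ln\<close> is
      continuous there.\<close>
    have "1 - w \<notin> \<real>\<^sub>\<le>\<^sub>0"
    proof
      assume "1 - w \<in> \<real>\<^sub>\<le>\<^sub>0"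
      then have "Re w \<ge> 1" "Im w = 0" by (auto simp: complex_nonpos_Reals_iff)
      moreover have "Re w \<le> 1" using complex_Re_le_cmod[of w] w(1) by linarith
      ultimately show False using w(2) by (auto simp: complex_eq_iff)
    qed
    then have "(\<lambda>n. - (1 - ?r n) * Ln (1 - ?r n)) \<longlonglongrightarrow> - (1 - w) * Ln (1 - w)"
      by (intro tendsto_intros r)
    moreover have "(\<lambda>n. ?r n - T (?r n)) \<longlonglongrightarrow> w - T w"
      using contT w(1) less_imp_le[OF norm_r]
      by (intro tendsto_intros r continuous_on_tendsto_compose[OF contT r]) auto
    ultimately show ?thesis using eq_ball[OF norm_r] by (auto dest: LIMSEQ_unique)
  qed
  have "bounded ((\<lambda>w. 1 / (1 - w)) ` S)"
    unfolding bounded_iff using assms(2)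
    by (intro exI[of _ "1 / \<epsilon>"]) (auto simp: S_def norm_divide intro!: frac_le)
  moreover have "bounded ((\<lambda>w. w - T w) ` S)"
  proof (rule bounded_subset)
    show "bounded ((\<lambda>w. w - T w) ` ?D)"
      by (intro compact_imp_bounded compact_continuous_image continuous_intros contT) auto
  qed (auto simp: S_def)
  ultimately have "uniform_limit S (\<lambda>N w. 1 / (1 - w) * ((1 - w) * (\<Sum>A<Suc N. w ^ Suc A / of_nat (Suc A))))
      (\<lambda>w. 1 / (1 - w) * (w - T w)) sequentially"
    by (intro uniform_lim_mult uniform_limit_const uniform_limit_on_subset[OF lim]) (auto simp: S_def)
  also have "?this \<longleftrightarrow> uniform_limit S (\<lambda>N w. \<Sum>A<Suc N. w ^ Suc A / of_nat (Suc A)) (\<lambda>w. - Ln (1 - w)) sequentially"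
  proof (rule uniform_limit_cong')
    fix w assume "w \<in> S"
    then have "w \<noteq> 1" "norm w \<le> 1" using assms(2) by (auto simp: S_def)
    have "w - T w = (1 - w) * (- Ln (1 - w))"
      using eq[OF \<open>norm w \<le> 1\<close> \<open>w \<noteq> 1\<close>] by (simp only: mult_minus_left mult_minus_right)
    with \<open>w \<noteq> 1\<close> show "1 / (1 - w) * ((1 - w) * (\<Sum>A<Suc N. w ^ Suc A / of_nat (Suc A))) = (\<Sum>A<Suc N. w ^ Suc A / of_nat (Suc A))"
      "1 / (1 - w) * (w - T w) = - Ln (1 - w)" for N
      by auto
  qed
  finally have lim_Suc: "uniform_limit S (\<lambda>N w. \<Sum>A<Suc N. w ^ Suc A / of_nat (Suc A)) (\<lambda>w. - Ln (1 - w)) sequentially" .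
  show ?thesis
  proof (rule uniform_limitI)
    fix e :: real assume "e > 0"
    from uniform_limitD[OF lim_Suc this]
    show "\<forall>\<^sub>F N in sequentially. \<forall>w\<in>S. dist (\<Sum>A<N. w ^ Suc A / of_nat (Suc A)) (- Ln (1 - w)) < e"
      by (subst eventually_sequentially_Suc[symmetric])
  qed
qed

section \<open>Boundary values Li_m(e(x)) of the polylogarithms\<close>

definition polylog_circle :: "nat \<Rightarrow> real \<Rightarrow> complex" where
  "polylog_circle m x = (\<Sum>A. expi (of_nat (Suc A) * of_real x) / of_nat (Suc A) ^ m)"

lemma polylog_circle_uniform_limit_UNIV:
  assumes "m \<ge> 2"
  shows "uniform_limit UNIV (\<lambda>N x. \<Sum>A<N. expi (of_nat (Suc A) * of_real x) / of_nat (Suc A) ^ m)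
    (polylog_circle m) sequentially"
  unfolding polylog_circle_def[abs_def]
proof (rule Weierstrass_m_test[OF _ summable_inverse_square])
  fix A and x :: real
  have "norm (expi (of_nat (Suc A) * of_real x)) = 1"
    using norm_expi_of_real[of "real (Suc A) * x"] by (simp only: of_real_mult of_real_of_nat_eq)
  moreover have "real (Suc A) ^ 2 \<le> real (Suc A) ^ m" using assms by (intro power_increasing) auto
  then have "1 / real (Suc A) ^ m \<le> 1 / real (Suc A) ^ 2" by (intro frac_le) auto
  ultimately show "norm (expi (of_nat (Suc A) * of_real x) / of_nat (Suc A) ^ m) \<le> 1 / real (Suc A) ^ 2"
    by (simp only: norm_divide norm_power norm_of_nat)
qed

lemma expi_neq_1: "0 < x \<Longrightarrow> x < 1 \<Longrightarrow> expi (of_real x) \<noteq> 1"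
  unfolding expi_of_real_eq_1_iff by (auto elim!: Ints_cases)

text \<open>On a compact interval inside (0, 1) the distance from e(x) to 1 attains a positive
  minimum, which serves as the \<epsilon> of \<open>log_series_uniform_limit\<close>.\<close>

lemma polylog_circle_1_limit:
  assumes "\<delta> > 0"
  shows "uniform_limit {\<delta>..1 - \<delta>} (\<lambda>N x. \<Sum>A<N. expi (of_nat (Suc A) * of_real x) / of_nat (Suc A) ^ 1)
    (\<lambda>x. - Ln (1 - expi (of_real x))) sequentially"
proof (cases "{\<delta>..1 - \<delta>} = {}")
  case False
  have "continuous_on {\<delta>..1 - \<delta>} (\<lambda>x. norm (1 - expi (of_real x)))"
    unfolding expi_def by (intro continuous_intros)
  then have "\<exists>y\<in>{\<delta>..1 - \<delta>}. \<forall>x\<in>{\<delta>..1 - \<delta>}. norm (1 - expi (of_real y)) \<le> norm (1 - expi (of_real x))"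
    using False by (intro continuous_attains_inf) auto
  then obtain y where y: "y \<in> {\<delta>..1 - \<delta>}"
    "\<And>x. x \<in> {\<delta>..1 - \<delta>} \<Longrightarrow> norm (1 - expi (of_real y)) \<le> norm (1 - expi (of_real x))"
    by blast
  have "norm (1 - expi (of_real y)) > 0" using expi_neq_1[of y] y(1) assms by auto
  from uniform_limit_compose'[OF log_series_uniform_limit[OF this], of "\<lambda>x. expi (of_real x)"] y(2)
  show ?thesis by (simp add: Pi_iff expi_power flip: power_Suc)
qed simp

lemma polylog_circle_1:
  assumes "0 < x" "x < 1"
  shows "polylog_circle 1 x = - Ln (1 - expi (of_real x))"
proof -
  have "(\<lambda>N. \<Sum>A<N. expi (of_nat (Suc A) * of_real x) / of_nat (Suc A) ^ 1) \<longlonglongrightarrow> - Ln (1 - expi (of_real x))"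
    using assms by (intro tendsto_uniform_limitI[OF polylog_circle_1_limit[of "min x (1 - x)"]]) auto
  then show ?thesis unfolding polylog_circle_def using sums_unique[symmetric] unfolding sums_def by blast
qed

lemma polylog_circle_uniform_limit:
  assumes "m \<ge> 1" "\<delta> > 0"
  shows "uniform_limit {\<delta>..1 - \<delta>} (\<lambda>N x. \<Sum>A<N. expi (of_nat (Suc A) * of_real x) / of_nat (Suc A) ^ m)
    (polylog_circle m) sequentially"
proof (cases "m = 1")
  case True
  have "uniform_limit {\<delta>..1 - \<delta>} (\<lambda>N x. \<Sum>A<N. expi (of_nat (Suc A) * of_real x) / of_nat (Suc A) ^ 1)
    (\<lambda>x. - Ln (1 - expi (of_real x))) sequentially"
    by (rule polylog_circle_1_limit[OF assms(2)])
  also have "?this \<longleftrightarrow> ?thesis"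
    unfolding True using assms(2) by (intro uniform_limit_cong') (auto simp: polylog_circle_1[unfolded One_nat_def])
  finally show ?thesis .
next
  case False
  then show ?thesis
    using assms(1) by (intro uniform_limit_on_subset[OF polylog_circle_uniform_limit_UNIV]) auto
qed

lemma polylog_circle_sums:
  assumes "m \<ge> 1" "0 < x" "x < 1"
  shows "(\<lambda>A. expi (of_nat (Suc A) * of_real x) / of_nat (Suc A) ^ m) sums polylog_circle m x"
  unfolding sums_def using assms
  by (intro tendsto_uniform_limitI[OF polylog_circle_uniform_limit[of m "min x (1 - x)"]]) auto

lemma continuous_on_polylog_circle: "m \<ge> 2 \<Longrightarrow> continuous_on UNIV (polylog_circle m)"
  by (rule uniform_limit_theorem[OF _ polylog_circle_uniform_limit_UNIV])
    (auto simp: expi_def simp del: of_nat_Suc intro!: always_eventually continuous_intros)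

text \<open>Termwise differentiation lowers the order by one and requires uniform convergence of the
  derived series. In order 1 this is available only away from the integers, hence the localisation
  around \<open>x\<close>.\<close>

lemma polylog_circle_has_derivative:
  assumes "m \<ge> 1" "0 < x" "x < 1"
  shows "(polylog_circle (Suc m) has_vector_derivative 2 * of_real pi * \<i> * polylog_circle m x) (at x)"
proof -
  \<comment> \<open>Halving puts \<open>x\<close> in the interior of the interval, so that the
    derivative within the interval is a full derivative.\<close>
  define \<delta> where "\<delta> = min x (1 - x) / 2"
  have \<delta>: "\<delta> > 0" "x \<in> interior {\<delta>..1 - \<delta>}" using assms by (auto simp: \<delta>_def min_def field_simps)
  let ?S = "{\<delta>..1 - \<delta>}"
  let ?f = "\<lambda>m A x. expi (of_nat (Suc A) * of_real x) / of_nat (Suc A) ^ m"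
  have "\<exists>g. \<forall>x\<in>?S. (\<lambda>n. ?f (Suc m) n x) sums g x \<and>
      (g has_derivative (\<lambda>h. h *\<^sub>R (2 * of_real pi * \<i> * polylog_circle m x))) (at x within ?S)"
  proof (rule has_derivative_series)
    fix n and y :: real
    have nz: "of_nat (Suc n) \<noteq> (0 :: complex)" by (simp only: of_nat_eq_0_iff)
    have "((\<lambda>z. exp (2 * of_real pi * \<i> * (of_nat (Suc n) * z)) / of_nat (Suc n) ^ Suc m) has_field_derivative
        exp (2 * of_real pi * \<i> * (of_nat (Suc n) * of_real y)) * (2 * of_real pi * \<i> * of_nat (Suc n)) / of_nat (Suc n) ^ Suc m)
        (at (of_real y))"
      using nz by (auto intro!: derivative_eq_intros simp del: of_nat_Suc power_Suc)
    also have "exp (2 * of_real pi * \<i> * (of_nat (Suc n) * of_real y)) * (2 * of_real pi * \<i> * of_nat (Suc n)) / of_nat (Suc n) ^ Suc m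
        = 2 * of_real pi * \<i> * ?f m n y"
      using nz by (simp add: expi_def field_simps del: of_nat_Suc)
    finally have "(?f (Suc m) n has_vector_derivative 2 * of_real pi * \<i> * ?f m n y) (at y within ?S)"
      unfolding expi_def[symmetric] by (rule has_vector_derivative_real_field)
    then show "(?f (Suc m) n has_derivative (\<lambda>h. h *\<^sub>R (2 * of_real pi * \<i> * ?f m n y))) (at y within ?S)"
      by (simp only: has_vector_derivative_def)
  next
    fix e :: real assume "e > 0"
    from uniform_limitD[OF polylog_circle_uniform_limit[OF assms(1) \<delta>(1)], of "e / (2 * pi)"] \<open>e > 0\<close>
    have "\<forall>\<^sub>F n in sequentially. \<forall>y\<in>?S. dist (\<Sum>A<n. ?f m A y) (polylog_circle m y) < e / (2 * pi)" by simp
    then show "\<forall>\<^sub>F n in sequentially. \<forall>y\<in>?S. \<forall>h. norm ((\<Sum>i<n. h *\<^sub>R (2 * of_real pi * \<i> * ?f m i y)) -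
        h *\<^sub>R (2 * of_real pi * \<i> * polylog_circle m y)) \<le> e * norm h"
    proof (eventually_elim, intro ballI allI)
      fix n y and h :: real
      assume *: "\<forall>y\<in>?S. dist (\<Sum>A<n. ?f m A y) (polylog_circle m y) < e / (2 * pi)" and "y \<in> ?S"
      then have "norm ((\<Sum>A<n. ?f m A y) - polylog_circle m y) * (2 * pi) \<le> e"
        by (auto simp: dist_norm field_simps dest!: bspec[of _ _ y] simp del: of_nat_Suc)
      then have "norm h * (norm ((\<Sum>A<n. ?f m A y) - polylog_circle m y) * (2 * pi)) \<le> norm h * e"
        by (intro mult_left_mono) auto
      moreover have "(\<Sum>i<n. h *\<^sub>R (2 * of_real pi * \<i> * ?f m i y)) - h *\<^sub>R (2 * of_real pi * \<i> * polylog_circle m y)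
          = h *\<^sub>R ((2 * of_real pi * \<i>) * ((\<Sum>A<n. ?f m A y) - polylog_circle m y))"
        by (simp only: scaleR_sum_right[symmetric] sum_distrib_left[symmetric] scaleR_diff_right right_diff_distrib)
      moreover have "norm (h *\<^sub>R ((2 * of_real pi * \<i>) * d)) = norm h * (norm d * (2 * pi))" for d :: complex
        by (simp add: norm_mult)
      ultimately show "norm ((\<Sum>i<n. h *\<^sub>R (2 * of_real pi * \<i> * ?f m i y)) -
        h *\<^sub>R (2 * of_real pi * \<i> * polylog_circle m y)) \<le> e * norm h"
        by (simp only: mult.commute[of e])
    qed
  next
    show "x \<in> ?S" using \<delta>(2) interior_subset by blast
    show "(\<lambda>n. ?f (Suc m) n x) sums polylog_circle (Suc m) x"
      using assms by (intro polylog_circle_sums) auto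
  qed auto
  then obtain g where g: "\<And>y. y \<in> ?S \<Longrightarrow> (\<lambda>n. ?f (Suc m) n y) sums g y"
    "\<And>y. y \<in> ?S \<Longrightarrow> (g has_derivative (\<lambda>h. h *\<^sub>R (2 * of_real pi * \<i> * polylog_circle m y))) (at y within ?S)"
    by blast
  have "g y = polylog_circle (Suc m) y" if "y \<in> ?S" for y
    using polylog_circle_sums[of "Suc m" y] g(1)[OF that] that \<delta>(1) sums_unique2 by fastforce
  moreover have "x \<in> ?S" using \<delta>(2) interior_subset by blast
  ultimately have "(polylog_circle (Suc m) has_derivative (\<lambda>h. h *\<^sub>R (2 * of_real pi * \<i> * polylog_circle m x))) (at x within ?S)"
    by (intro has_derivative_transform[OF _ _ g(2)]) auto
  then show ?thesis
    using at_within_interior[OF \<delta>(2)] by (simp add: has_vector_derivative_def)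
qed

text \<open>1 - e(x) is 2 sin(pi x) exp(i pi (x - 1/2)), and for 0 < x < 1 the angle lies between
  -pi/2 and pi/2, so it is the principal one.\<close>

lemma Ln_1_minus_expi:
  assumes "0 < x" "x < 1"
  shows "Ln (1 - expi (of_real x)) = of_real (ln (2 * sin (pi * x))) + \<i> * of_real (pi * (x - 1 / 2))"
proof (rule Ln_unique)
  have sin: "sin (pi * x) > 0" using assms by (intro sin_gt_zero) auto
  have "exp (of_real (ln (2 * sin (pi * x))) + \<i> * of_real (pi * (x - 1 / 2))) =
      of_real (2 * sin (pi * x)) * cis (pi * x - pi / 2)"
    using sin by (simp only: exp_add exp_of_real cis_conv_exp[symmetric]) (simp add: algebra_simps)
  also have "\<dots> = 1 - cis (2 * (pi * x))"
  proof -
    have "of_real (2 * sin y) * cis (y - pi / 2) = 1 - cis (2 * y)" for y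
      by (simp add: complex_eq_iff cos_diff sin_diff cos_double_sin sin_double power2_eq_square)
    then show ?thesis .
  qed
  also have "cis (2 * (pi * x)) = expi (of_real x)"
    by (simp add: expi_def cis_conv_exp mult_ac)
  finally show "exp (of_real (ln (2 * sin (pi * x))) + \<i> * of_real (pi * (x - 1 / 2))) = 1 - expi (of_real x)" .
  have "- 1 < x - 1 / 2" "x - 1 / 2 \<le> 1" using assms by auto
  then have "pi * (- 1) < pi * (x - 1 / 2)" "pi * (x - 1 / 2) \<le> pi * 1"
    by (intro mult_strict_left_mono mult_left_mono; simp)+
  then show "- pi < Im (of_real (ln (2 * sin (pi * x))) + \<i> * of_real (pi * (x - 1 / 2)))"
    "Im (of_real (ln (2 * sin (pi * x))) + \<i> * of_real (pi * (x - 1 / 2))) \<le> pi" by auto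
qed

section \<open>Bernoulli polynomials and their Fourier series\<close>

lemma bernoulli_poly_1: "bernoulli_poly 1 x = x - 1 / 2"
  by (simp add: bernoulli_poly_def)

lemma bernoulli_poly_has_derivative:
  "(bernoulli_poly (Suc m) has_real_derivative of_nat (Suc m) * bernoulli_poly m x) (at x)"
proof -
  let ?D = "\<Sum>j\<le>Suc m. real (Suc m choose j) * bernoulli_num j * (real (Suc m - j) * x ^ (Suc m - j - 1))"
  have "(bernoulli_poly (Suc m) has_real_derivative ?D) (at x)"
    unfolding bernoulli_poly_def[abs_def] by (rule DERIV_sum) (auto intro!: derivative_eq_intros)
  also have "?D = (\<Sum>j\<le>m. real (Suc m choose j) * bernoulli_num j * (real (Suc m - j) * x ^ (m - j)))"
    by simp
  also have "\<dots> = of_nat (Suc m) * bernoulli_poly m x"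
    unfolding bernoulli_poly_def sum_distrib_left
  proof (intro sum.cong refl)
    fix j assume "j \<in> {..m}"
    then have "(Suc m choose j) * (Suc m - j) = Suc m * (m choose j)"
      by (metis Suc_diff_le atMost_iff binomial_absorb_comp diff_Suc_1 mult.commute)
    then have "real (Suc m choose j) * real (Suc m - j) = real (Suc m) * real (m choose j)"
      by (metis of_nat_mult)
    then have "real (Suc m choose j) * real (Suc m - j) * (bernoulli_num j * x ^ (m - j)) =
      real (Suc m) * real (m choose j) * (bernoulli_num j * x ^ (m - j))" by (simp only:)
    then show "real (Suc m choose j) * bernoulli_num j * (real (Suc m - j) * x ^ (m - j)) =
      real (Suc m) * (real (m choose j) * bernoulli_num j * x ^ (m - j))"
      by (simp only: mult_ac)
  qed
  finally show ?thesis .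
qed

text \<open>The recursion for the Bernoulli numbers says exactly that the terms below the top index
  cancel at 1, while at 0 only the top index survives. In degree 1 the values are 1/2 and
  -1/2.\<close>

lemma bernoulli_poly_0_1:
  assumes "m \<ge> 2"
  shows "bernoulli_poly m 1 = bernoulli_poly m 0"
proof -
  obtain l where m: "m = Suc (Suc l)" using assms by (metis add_2_eq_Suc le_Suc_ex)
  have "(\<Sum>j\<le>Suc l. real (m choose j) * bernoulli_num j) = 0"
    by (simp add: m del: binomial_Suc_Suc)
  then have "bernoulli_poly m 1 = bernoulli_num m"
    by (simp add: bernoulli_poly_def m)
  moreover have "bernoulli_poly m 0 = (\<Sum>j\<in>{m}. real (m choose j) * bernoulli_num j * 0 ^ (m - j))"
    unfolding bernoulli_poly_def by (intro sum.mono_neutral_right) auto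
  ultimately show ?thesis by simp
qed

text \<open>The difference of the two sides of the Fourier expansion in degree \<open>m + 1\<close> is constant, and
  the periodicity of the difference in degree \<open>m + 2\<close> forces that constant to vanish.\<close>
theorem bernoulli_poly_fourier:
  assumes "m \<ge> 1" "0 < x" "x < 1"
  shows "polylog_circle m x + (-1) ^ m * polylog_circle m (1 - x) =
    - ((2 * of_real pi * \<i>) ^ m / fact m * of_real (bernoulli_poly m x))"
proof -
  define D where "D = (\<lambda>m x. polylog_circle m x + (-1) ^ m * polylog_circle m (1 - x) +
    (2 * of_real pi * \<i>) ^ m / fact m * of_real (bernoulli_poly m x))"
  have deriv: "(D (Suc m) has_vector_derivative 2 * of_real pi * \<i> * D m x) (at x)"
    if "m \<ge> 1" "0 < x" "x < 1" for m x
  proof -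
    have 1: "((\<lambda>x. polylog_circle (Suc m) (1 - x)) has_vector_derivative
        - (2 * of_real pi * \<i> * polylog_circle m (1 - x))) (at x)"
    proof -
      have "((\<lambda>x. 1 - x) has_vector_derivative - 1) (at x)"
        by (auto intro!: derivative_eq_intros)
      from vector_diff_chain_at[OF this polylog_circle_has_derivative[of m]] that
      show ?thesis by (simp add: o_def)
    qed
    have 2: "((\<lambda>x. of_real (bernoulli_poly (Suc m) x)) has_vector_derivative
        of_real (of_nat (Suc m) * bernoulli_poly m x)) (at x)"
      using bernoulli_poly_has_derivative[of m x]
      by (intro has_vector_derivative_of_real) (simp add: has_real_derivative_iff_has_vector_derivative)
    have "(D (Suc m) has_vector_derivative 2 * of_real pi * \<i> * polylog_circle m x +
        (-1) ^ Suc m * - (2 * of_real pi * \<i> * polylog_circle m (1 - x)) +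
        (2 * of_real pi * \<i>) ^ Suc m / fact (Suc m) * of_real (of_nat (Suc m) * bernoulli_poly m x)) (at x)"
      unfolding D_def
      by (intro has_vector_derivative_add has_vector_derivative_mult_right 1 2
          polylog_circle_has_derivative that)
    also have "2 * of_real pi * \<i> * polylog_circle m x +
        (-1) ^ Suc m * - (2 * of_real pi * \<i> * polylog_circle m (1 - x)) +
        (2 * of_real pi * \<i>) ^ Suc m / fact (Suc m) * of_real (of_nat (Suc m) * bernoulli_poly m x) =
        2 * of_real pi * \<i> * D m x"
    proof -
      have nz: "of_nat (Suc m) \<noteq> (0 :: complex)" by (simp only: of_nat_eq_0_iff)
      have "y ^ Suc m / fact (Suc m) * of_real (of_nat (Suc m) * b) = y * (y ^ m / fact m * of_real b)"
        for y :: complex and b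
        using nz by (simp add: fact_Suc field_simps del: of_nat_Suc)
      then show ?thesis unfolding D_def by (simp only: distrib_left power_Suc) simp
    qed
    finally show ?thesis .
  qed
  have cont: "continuous_on {0..1} (D m)" if "m \<ge> 2" for m
  proof -
    have "continuous_on {0..1} (bernoulli_poly m)"
      unfolding bernoulli_poly_def[abs_def] by (intro continuous_intros)
    moreover have "continuous_on {0..1} (\<lambda>x. polylog_circle m (1 - x))"
      by (intro continuous_on_compose2[OF continuous_on_polylog_circle[OF that]] continuous_intros) auto
    ultimately show ?thesis unfolding D_def
      by (intro continuous_intros continuous_on_subset[OF continuous_on_polylog_circle[OF that]]) auto
  qed
  have periodic: "D m 1 = D m 0" if "m \<ge> 2" for m
  proof -
    have "polylog_circle m 1 = polylog_circle m 0"
    proof -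
      have "expi (of_nat (Suc A)) = expi 0" for A
        using expi_of_int[of "int (Suc A)"] expi_of_int[of 0] by simp
      then show ?thesis by (simp add: polylog_circle_def del: of_nat_Suc)
    qed
    then show ?thesis by (simp add: D_def bernoulli_poly_0_1[OF that])
  qed
  have "\<forall>x. 0 < x \<longrightarrow> x < 1 \<longrightarrow> D m x = 0"
    using assms(1)
  proof (induction m rule: nat_induct_at_least)
    case base
    show ?case
    proof (intro allI impI)
      fix x :: real assume x: "0 < x" "x < 1"
      \<comment> \<open>The real parts of the two logarithms agree and cancel, which leaves the
        imaginary part, linear in x.\<close>
      have "sin (pi * (1 - x)) = sin (pi * x)" by (simp add: algebra_simps sin_diff)
      then have "polylog_circle 1 (1 - x) = - (of_real (ln (2 * sin (pi * x))) + \<i> * of_real (pi * (1 - x - 1 / 2)))"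
        using x polylog_circle_1[of "1 - x"] Ln_1_minus_expi[of "1 - x"] by simp
      moreover have "polylog_circle 1 x = - (of_real (ln (2 * sin (pi * x))) + \<i> * of_real (pi * (x - 1 / 2)))"
        using x polylog_circle_1[of x] Ln_1_minus_expi[of x] by simp
      ultimately show "D 1 x = 0"
        unfolding D_def bernoulli_poly_1 by (simp add: complex_eq_iff) (simp add: algebra_simps)
    qed
  next
    case (Suc m)
    have m: "m \<ge> 1" "Suc m \<ge> 2" "Suc (Suc m) \<ge> 2" using Suc.hyps by auto
    have const: "D (Suc m) x = D (Suc m) 0" if "0 \<le> x" "x \<le> 1" for x
    proof -
      have "((\<lambda>_. 0) has_integral (D (Suc m) x - D (Suc m) 0)) {0..x}"
      proof (rule fundamental_theorem_of_calculus_interior)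
        show "continuous_on {0..x} (D (Suc m))"
          using that by (intro continuous_on_subset[OF cont[OF m(2)]]) auto
        show "(D (Suc m) has_vector_derivative 0) (at y)" if "y \<in> {0<..<x}" for y
          using deriv[OF m(1), of y] Suc.IH that \<open>x \<le> 1\<close> by auto
      qed (use that in auto)
      then show ?thesis by (simp add: has_integral_0_eq)
    qed
    have "((\<lambda>_. 2 * of_real pi * \<i> * D (Suc m) 0) has_integral (D (Suc (Suc m)) 1 - D (Suc (Suc m)) 0)) {0..1::real}"
    proof (rule fundamental_theorem_of_calculus_interior[where f = "D (Suc (Suc m))"])
      show "(D (Suc (Suc m)) has_vector_derivative 2 * of_real pi * \<i> * D (Suc m) 0) (at y)"
        if "y \<in> {0<..<1}" for y
        using deriv[of "Suc m" y] const[of y] that by auto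
    qed (use cont[OF m(3)] in auto)
    moreover have "((\<lambda>_. 2 * of_real pi * \<i> * D (Suc m) 0) has_integral (2 * of_real pi * \<i> * D (Suc m) 0)) {0..1::real}"
      using has_integral_const_real[of "2 * of_real pi * \<i> * D (Suc m) 0" 0 1] by simp
    ultimately have "D (Suc m) 0 = 0"
      using periodic[OF m(3)] by (auto dest: has_integral_unique)
    then show ?case by (metis const less_imp_le)
  qed
  then show ?thesis using assms(2,3) unfolding D_def by (simp add: add_eq_0_iff)
qed

section \<open>Generating functions of periodic sequences with mean zero\<close>

lemma summable_power_times_exp: "summable (\<lambda>n. real n ^ j * exp (- real n))"
proof (rule summable_comparison_test_bigo)
  have "summable (\<lambda>n. exp (- 1 / 2) ^ n :: real)" by (intro summable_geometric) simp
  then show "summable (\<lambda>n. norm (exp (- real n / 2)))"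
    by (simp add: exp_of_nat_mult[symmetric])
  show "(\<lambda>n. real n ^ j * exp (- real n)) \<in> O(\<lambda>n. exp (- real n / 2))"
    by real_asymp
qed

text \<open>Models one row B -> f A B of the coefficient array. The condition \<open>f 0 = 0\<close>
  removes the constant term of the generating function, which gives exponential decay.\<close>

locale zero_mean_periodic =
  fixes f :: "nat \<Rightarrow> complex" and c :: nat
  assumes c_pos: "c > 0" and periodic: "f (n + c) = f n" and f_0: "f 0 = 0"
    and zero_mean: "(\<Sum>n<c. f n) = 0"
begin

text \<open>This is (1 - z^c) / (1 - z) for z = exp (- u), continued to u = 0, where it takes the
  nonzero value c.\<close>

definition denom :: "complex \<Rightarrow> complex" where
  "denom u = (\<Sum>j<c. exp (- u) ^ j)"

text \<open>The value of \<open>\<Sum>n. f n * exp (- n u)\<close> after cancelling the common factor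
  \<open>1 - exp (- u)\<close>, hence regular at \<open>u = 0\<close>.\<close>
definition gen_fun :: "complex \<Rightarrow> complex" where
  "gen_fun u = (\<Sum>n<c. (\<Sum>j\<le>n. f j) * exp (- u) ^ n) / denom u"

text \<open>An open set containing the right half plane, where the series converges, and also the
  whole real line, so that derivatives at 0 are available.\<close>

definition reg :: "complex set" where "reg = {u. denom u \<noteq> 0}"

lemma f_bounded: "\<exists>K. \<forall>n. norm (f n) \<le> K"
proof -
  have "f n = f (n mod c)" for n
  proof (induction n rule: less_induct)
    case (less n)
    show ?case
    proof (cases "n < c")
      case False
      then have "f n = f (n - c)" using periodic[of "n - c"] by simp
      also have "\<dots> = f ((n - c) mod c)" using False c_pos by (intro less) auto
      also have "(n - c) mod c = n mod c" using False by (simp add: le_mod_geq)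
      finally show ?thesis .
    qed simp
  qed
  then have "norm (f n) \<le> Max ((\<lambda>n. norm (f n)) ` {..<c})" for n
    using c_pos by (metis Max_ge finite_imageI finite_lessThan image_eqI lessThan_iff mod_less_divisor)
  then show ?thesis by blast
qed

lemma denom_times: "(1 - exp (- u)) * denom u = 1 - exp (- u) ^ c"
  unfolding denom_def by (rule one_diff_power_eq[symmetric])

lemma Re_pos_in_reg: 
  assumes "Re u > 0" shows "u \<in> reg"
proof -
  have "norm (exp (- u) ^ c) < 1" 
    using assms c_pos by (simp add: norm_power power_less_one_iff)
  then have "exp (- u) ^ c \<noteq> 1" by auto
  then show ?thesis using denom_times[of u] by (auto simp: reg_def)
qed

lemma of_real_in_reg: "of_real x \<in> reg"
proof -
  have "denom (of_real x) = of_real (\<Sum>j<c. exp (- x) ^ j)"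
    by (simp add: denom_def exp_of_real flip: of_real_minus)
  moreover have "(\<Sum>j<c. exp (- x) ^ j) > 0" using c_pos by (intro sum_pos) auto
  ultimately show ?thesis by (simp only: reg_def mem_Collect_eq of_real_eq_0_iff)
qed

lemma open_reg: "open reg"
proof -
  have "continuous_on UNIV denom" unfolding denom_def by (intro continuous_intros)
  then have "open (denom -` (- {0}))" by (intro open_vimage) auto
  then show ?thesis by (simp add: reg_def vimage_def)
qed

lemma holomorphic_gen_fun: "gen_fun holomorphic_on reg"
  unfolding gen_fun_def denom_def by (intro holomorphic_intros) (simp add: reg_def denom_def)

text \<open>By periodicity the series is its first period divided by 1 - z^c. Abel summation over
  that period extracts a factor 1 - z; the boundary term is the total over a period, which is
  0.\<close>

lemma gen_fun_sums:
  assumes "Re u > 0"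
  shows "(\<lambda>n. f n * exp (- u) ^ n) sums gen_fun u"
proof -
  define z where "z = exp (- u)"
  have z: "norm z < 1" using assms by (simp add: z_def)
  obtain K where K: "\<And>n. norm (f n) \<le> K" using f_bounded by blast
  have "summable (\<lambda>n. f n * z ^ n)"
  proof (rule summable_comparison_test')
    show "summable (\<lambda>n. K * norm z ^ n)" using z by (intro summable_mult summable_geometric) simp
    show "norm (f n * z ^ n) \<le> K * norm z ^ n" for n
      using K[of n] by (simp add: norm_mult norm_power mult_right_mono)
  qed
  then obtain s where s: "(\<lambda>n. f n * z ^ n) sums s" by (auto simp: summable_def)
  have "(\<lambda>n. z ^ c * (f n * z ^ n)) sums (z ^ c * s)" by (rule sums_mult[OF s])
  moreover have "z ^ c * (f n * z ^ n) = f (n + c) * z ^ (n + c)" for n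
    by (simp add: periodic power_add)
  moreover have "(\<lambda>n. f (n + c) * z ^ (n + c)) sums (s - (\<Sum>n<c. f n * z ^ n))"
    by (rule sums_split_initial_segment[OF s])
  ultimately have "z ^ c * s = s - (\<Sum>n<c. f n * z ^ n)" by (simp add: sums_unique2)
  then have *: "(1 - z ^ c) * s = (\<Sum>n<c. f n * z ^ n)" by (simp add: algebra_simps)
  have "(1 - z) * (\<Sum>n<N. (\<Sum>j\<le>n. f j) * z ^ n) = (\<Sum>n<N. f n * z ^ n) - (\<Sum>n<N. f n) * z ^ N" for N
  proof (induction N)
    case (Suc N)
    have partial: "(\<Sum>j\<le>N. f j) = (\<Sum>j<N. f j) + f N"
      by (metis lessThan_Suc_atMost sum.lessThan_Suc)
    have "(1 - z) * (\<Sum>n<Suc N. (\<Sum>j\<le>n. f j) * z ^ n) =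
      (1 - z) * (\<Sum>n<N. (\<Sum>j\<le>n. f j) * z ^ n) + (1 - z) * ((\<Sum>j\<le>N. f j) * z ^ N)"
      by (simp add: distrib_left)
    also have "\<dots> = (\<Sum>n<N. f n * z ^ n) - (\<Sum>n<N. f n) * z ^ N + (1 - z) * (((\<Sum>j<N. f j) + f N) * z ^ N)"
      by (simp only: Suc.IH partial)
    also have "\<dots> = (\<Sum>n<Suc N. f n * z ^ n) - (\<Sum>n<Suc N. f n) * z ^ Suc N"
      by (simp add: algebra_simps)
    finally show ?case .
  qed simp
  from this[of c] have "(1 - z) * (denom u * gen_fun u) = (\<Sum>n<c. f n * z ^ n)"
    using Re_pos_in_reg[OF assms] by (simp add: gen_fun_def reg_def z_def zero_mean)
  then have "(1 - z ^ c) * gen_fun u = (1 - z ^ c) * s"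
    using denom_times[of u] * by (simp add: z_def mult.assoc[symmetric])
  moreover have "1 - z ^ c \<noteq> 0"
  proof -
    have "norm (z ^ c) < 1" using z c_pos by (simp add: norm_power power_less_one_iff)
    then show ?thesis by auto
  qed
  ultimately show ?thesis using s by (simp add: z_def)
qed

text \<open>Interchanging the double sum gives \<open>f n\<close> the coefficient c - n, and the
  constant part c drops out by mean zero.\<close>

lemma gen_fun_0: "gen_fun 0 = - (\<Sum>n<c. of_nat n * f n) / of_nat c"
proof -
  have "(\<Sum>n<N. \<Sum>j\<le>n. f j) = of_nat N * (\<Sum>n<N. f n) - (\<Sum>n<N. of_nat n * f n)" for N
    by (induction N) (simp_all add: lessThan_Suc_atMost[symmetric] algebra_simps)
  then show ?thesis by (simp add: gen_fun_def denom_def zero_mean)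
qed

lemma higher_deriv_exp_sum:
  "(deriv ^^ j) (\<lambda>u. \<Sum>n<N. f n * exp (- u) ^ n) = (\<lambda>u. \<Sum>n<N. f n * (- of_nat n) ^ j * exp (- u) ^ n)"
proof (induction j)
  case (Suc j)
  have "((\<lambda>u. \<Sum>n<N. f n * (- of_nat n) ^ j * exp (- u) ^ n) has_field_derivative
      (\<Sum>n<N. f n * (- of_nat n) ^ Suc j * exp (- u) ^ n)) (at u)" for u
    unfolding exp_of_nat_mult[symmetric]
    by (intro DERIV_sum) (auto intro!: derivative_eq_intros)
  then show ?case by (simp add: Suc DERIV_imp_deriv fun_eq_iff del: power_Suc)
qed simp

text \<open>On the half plane Re v > Re u / 2 the partial sums have a geometric majorant, so they
  converge uniformly and holomorphy lets all derivatives pass to the limit.\<close>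

lemma higher_deriv_gen_fun_sums:
  assumes "Re u > 0"
  shows "(\<lambda>n. f n * (- of_nat n) ^ j * exp (- u) ^ n) sums (deriv ^^ j) gen_fun u"
proof -
  define A where "A = {v. Re v > Re u / 2}"
  obtain K where K: "\<And>n. norm (f n) \<le> K" using f_bounded by blast
  have "K \<ge> 0" using K[of 0] norm_ge_zero by (rule order.trans[rotated])
  have "uniform_limit A (\<lambda>N v. \<Sum>n<N. f n * exp (- v) ^ n) (\<lambda>v. \<Sum>n. f n * exp (- v) ^ n) sequentially"
  proof (rule Weierstrass_m_test)
    show "summable (\<lambda>n. K * exp (- Re u / 2) ^ n)"
      using assms by (intro summable_mult summable_geometric) simp
    fix n v assume "v \<in> A"
    then have "norm (exp (- v) ^ n) \<le> exp (- Re u / 2) ^ n"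
      unfolding norm_power by (intro power_mono) (auto simp: A_def)
    then show "norm (f n * exp (- v) ^ n) \<le> K * exp (- Re u / 2) ^ n"
      unfolding norm_mult using K[of n] \<open>K \<ge> 0\<close> by (intro mult_mono) auto
  qed
  also have "?this \<longleftrightarrow> uniform_limit A (\<lambda>N v. \<Sum>n<N. f n * exp (- v) ^ n) gen_fun sequentially"
  proof (rule uniform_limit_cong')
    show "(\<Sum>n. f n * exp (- v) ^ n) = gen_fun v" if "v \<in> A" for v
      using that assms by (intro sums_unique[symmetric] gen_fun_sums) (auto simp: A_def)
  qed simp
  finally have "(\<lambda>N. (deriv ^^ j) (\<lambda>u. \<Sum>n<N. f n * exp (- u) ^ n) u) \<longlonglongrightarrow> (deriv ^^ j) gen_fun u"
  proof (rule higher_deriv_complex_uniform_limit)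
    show "open A" unfolding A_def by (rule open_halfspace_Re_gt)
    show "\<forall>\<^sub>F N in sequentially. (\<lambda>v. \<Sum>n<N. f n * exp (- v) ^ n) holomorphic_on A"
      by (intro always_eventually allI holomorphic_intros)
  qed (use assms in \<open>auto simp: A_def\<close>)
  then show ?thesis unfolding higher_deriv_exp_sum sums_def .
qed

text \<open>The series gives no control near 0, so continuity on the compact interval [0, 1] is used
  there; from 1 onwards the series itself provides the decay.\<close>

lemma higher_deriv_gen_fun_bound: "\<exists>K>0. \<forall>x\<ge>0. norm ((deriv ^^ j) gen_fun (of_real x)) \<le> K * exp (- x)"
proof -
  obtain K0 where K0: "\<And>n. norm (f n) \<le> K0" using f_bounded by blast
  have "K0 \<ge> 0" using K0[of 0] norm_ge_zero by (rule order.trans[rotated])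
  have "continuous_on reg ((deriv ^^ j) gen_fun)"
    by (intro holomorphic_on_imp_continuous_on holomorphic_higher_deriv holomorphic_gen_fun open_reg)
  then have "continuous_on {0..1::real} (\<lambda>x. (deriv ^^ j) gen_fun (of_real x))"
    by (rule continuous_on_compose2) (auto intro!: continuous_intros of_real_in_reg)
  then have "bounded ((\<lambda>x. (deriv ^^ j) gen_fun (of_real x)) ` {0..1::real})"
    by (intro compact_imp_bounded compact_continuous_image) auto
  then obtain K1 where K1: "K1 > 0" "\<And>x. x \<in> {0..1::real} \<Longrightarrow> norm ((deriv ^^ j) gen_fun (of_real x)) \<le> K1"
    unfolding bounded_pos by auto
  define K2 where "K2 = (\<Sum>n. K0 * exp 1 * (real n ^ j * exp (- real n)))"
  have summable: "summable (\<lambda>n. K0 * exp 1 * (real n ^ j * exp (- real n)))"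
    by (intro summable_mult summable_power_times_exp)
  have "K2 \<ge> 0" unfolding K2_def using \<open>K0 \<ge> 0\<close> by (intro suminf_nonneg summable) auto
  have K2: "norm ((deriv ^^ j) gen_fun (of_real x)) \<le> K2 * exp (- x)" if "x \<ge> 1" for x
  proof -
    have le: "norm (f n * (- of_nat n) ^ j * exp (- of_real x) ^ n) \<le> K0 * exp 1 * (real n ^ j * exp (- real n)) * exp (- x)" for n
    proof (cases "n = 0")
      case False
      \<comment> \<open>This yields n x \<ge> n + x - 1, separating the decay in x from a factor
        summable in n. It requires n \<ge> 1; the term n = 0 vanishes by \<open>f_0\<close>.\<close>
      then have "0 \<le> (real n - 1) * (x - 1)" using that by (intro mult_nonneg_nonneg) auto
      then have "exp (- (real n * x)) \<le> exp (1 - real n - x)" by (simp add: algebra_simps)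
      then have "norm (f n) * (real n ^ j * exp (- (real n * x))) \<le> K0 * (real n ^ j * exp (1 - real n - x))"
        using K0[of n] \<open>K0 \<ge> 0\<close> by (intro mult_mono) auto
      moreover have "norm (exp (- of_real x :: complex) ^ n) = exp (- (real n * x))"
        by (simp add: norm_power exp_of_nat_mult[symmetric])
      moreover have "exp (1 - real n - x) = exp 1 * exp (- real n) * exp (- x)"
        by (simp add: exp_add[symmetric])
      ultimately show ?thesis by (simp add: norm_mult norm_power mult_ac)
    qed (simp add: f_0 \<open>K0 \<ge> 0\<close>)
    have sums: "(\<lambda>n. f n * (- of_nat n) ^ j * exp (- of_real x) ^ n) sums (deriv ^^ j) gen_fun (of_real x)"
      using that by (intro higher_deriv_gen_fun_sums) auto
    have "norm (suminf (\<lambda>n. f n * (- of_nat n) ^ j * exp (- of_real x) ^ n)) \<le>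
        (\<Sum>n. K0 * exp 1 * (real n ^ j * exp (- real n)) * exp (- x))"
      by (intro norm_suminf_le le summable_mult2 summable)
    also have "\<dots> = K2 * exp (- x)" unfolding K2_def by (rule suminf_mult2[symmetric, OF summable])
    finally show ?thesis using sums_unique[OF sums] by simp
  qed
  have "norm ((deriv ^^ j) gen_fun (of_real x)) \<le> (K1 * exp 1 + K2) * exp (- x)" if "x \<ge> 0" for x
  proof (cases "x \<le> 1")
    case True
    have "norm ((deriv ^^ j) gen_fun (of_real x)) \<le> K1 * 1" using K1(2)[of x] that True by simp
    also have "\<dots> \<le> K1 * exp (1 - x)" using True K1(1) by (intro mult_left_mono) auto
    also have "\<dots> = K1 * exp 1 * exp (- x)" by (simp add: exp_add[symmetric])
    also have "\<dots> \<le> (K1 * exp 1 + K2) * exp (- x)" using \<open>K2 \<ge> 0\<close> by (intro mult_right_mono) auto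
    finally show ?thesis .
  next
    case False
    then have "norm ((deriv ^^ j) gen_fun (of_real x)) \<le> K2 * exp (- x)" by (intro K2) auto
    also have "\<dots> \<le> (K1 * exp 1 + K2) * exp (- x)" using K1(1) by (intro mult_right_mono) auto
    finally show ?thesis .
  qed
  moreover have "K1 * exp 1 + K2 > 0" using K1(1) \<open>K2 \<ge> 0\<close> by (intro add_pos_nonneg) auto
  ultimately show ?thesis by blast
qed

lemma higher_deriv_gen_fun_has_derivative:
  "((\<lambda>x. (deriv ^^ j) gen_fun (of_real x)) has_vector_derivative (deriv ^^ Suc j) gen_fun (of_real x)) (at x)"
proof -
  have "((deriv ^^ j) gen_fun has_field_derivative deriv ((deriv ^^ j) gen_fun) (of_real x)) (at (of_real x))"
    using holomorphic_higher_deriv[OF holomorphic_gen_fun open_reg] open_reg of_real_in_reg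
    by (rule holomorphic_derivI)
  then show ?thesis by (simp add: has_vector_derivative_real_field)
qed

end

section \<open>Moment integrals\<close>

text \<open>The function is the norm of the complex Gamma integrand at exponent n + 1; being Borel,
  it passes from the completed measure to \<open>lborel\<close>.\<close>

lemma set_integrable_power_exp:
  fixes \<alpha> :: real
  assumes "\<alpha> > 0"
  shows "set_integrable lborel {0<..} (\<lambda>t. t ^ n * exp (- (\<alpha> * t)))"
proof -
  let ?f = "\<lambda>t. complex_of_real t powr (of_nat (Suc n) - 1) / of_real (exp (\<alpha> * t))"
  have "?f absolutely_integrable_on {0<..}"
    using assms by (intro absolutely_integrable_Gamma_integral) auto
  then have "set_integrable lebesgue {0<..} (\<lambda>t. norm (?f t))" by (rule set_integrable_norm)
  also have "?this \<longleftrightarrow> set_integrable lebesgue {0<..} (\<lambda>t. t ^ n * exp (- (\<alpha> * t)))"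
    by (intro set_integrable_cong refl)
      (auto simp: norm_divide norm_power norm_powr_real_powr powr_realpow exp_minus field_simps)
  finally show ?thesis unfolding set_integrable_def
    by (subst (asm) integrable_completion) auto
qed

text \<open>\<open>g j\<close> is the j-th derivative of \<open>g 0\<close>. The interface is shared
  by exp (- x), which yields the Gamma integral, and by the row generating functions.\<close>

locale decaying_derivatives =
  fixes g :: "nat \<Rightarrow> real \<Rightarrow> complex"
  assumes deriv: "(g j has_vector_derivative g (Suc j) x) (at x)"
    and decay: "\<exists>K. \<forall>x\<ge>0. norm (g j x) \<le> K * exp (- x)"
begin

lemma continuous: "continuous_on A (g j)"
  using deriv has_vector_derivative_continuous by (blast intro: continuous_at_imp_continuous_on)

lemma continuous_scaled: "continuous_on A (\<lambda>t. g j (\<alpha> * t))"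
  by (rule continuous_on_compose2[OF continuous[of UNIV]]) (auto intro!: continuous_intros)

lemma set_integrable_moment:
  assumes "\<alpha> > 0"
  shows "set_integrable lborel {0<..} (\<lambda>t. of_real t ^ n * g j (\<alpha> * t))"
proof -
  obtain K where K: "\<And>x. x \<ge> 0 \<Longrightarrow> norm (g j x) \<le> K * exp (- x)" using decay by blast
  have "continuous_on UNIV (\<lambda>t. of_real t ^ n * g j (\<alpha> * t))"
    by (intro continuous_intros continuous_scaled)
  then have meas: "(\<lambda>t. of_real t ^ n * g j (\<alpha> * t)) \<in> borel_measurable borel"
    by (rule borel_measurable_continuous_onI)
  show ?thesis
  proof (rule set_integrable_bound)
    show "set_integrable lborel {0<..} (\<lambda>t. K * (t ^ n * exp (- (\<alpha> * t))))"
      using set_integrable_power_exp[OF assms] by (rule set_integrable_mult_right)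
    show "set_borel_measurable lborel {0<..} (\<lambda>t. of_real t ^ n * g j (\<alpha> * t))"
      unfolding set_borel_measurable_def using meas by measurable
    show "AE t in lborel. t \<in> {0<..} \<longrightarrow> norm (of_real t ^ n * g j (\<alpha> * t)) \<le> norm (K * (t ^ n * exp (- (\<alpha> * t))))"
    proof (intro AE_I2 impI)
      fix t :: real assume "t \<in> {0<..}"
      then have "t > 0" "\<alpha> * t \<ge> 0" using assms by auto
      have "norm (of_real t ^ n * g j (\<alpha> * t)) = t ^ n * norm (g j (\<alpha> * t))"
        using \<open>t > 0\<close> by (simp add: norm_mult norm_power)
      also have "\<dots> \<le> t ^ n * (K * exp (- (\<alpha> * t)))"
        using \<open>t > 0\<close> K[OF \<open>\<alpha> * t \<ge> 0\<close>] by (intro mult_left_mono) auto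
      also have "\<dots> \<le> norm (K * (t ^ n * exp (- (\<alpha> * t))))" by (simp add: mult_ac)
      finally show "norm (of_real t ^ n * g j (\<alpha> * t)) \<le> norm (K * (t ^ n * exp (- (\<alpha> * t))))" .
    qed
  qed
qed

lemma moment_tendsto_0:
  assumes "\<alpha> > 0"
  shows "((\<lambda>t. of_real t ^ n * g j (\<alpha> * t)) \<longlongrightarrow> 0) at_top"
proof -
  obtain K where K: "\<And>x. x \<ge> 0 \<Longrightarrow> norm (g j x) \<le> K * exp (- x)" using decay by blast
  have "((\<lambda>t::real. K * (t ^ n * exp (- (\<alpha> * t)))) \<longlongrightarrow> K * 0) at_top"
    by (intro tendsto_mult_left) (use assms in real_asymp)
  then have "((\<lambda>t::real. K * (t ^ n * exp (- (\<alpha> * t)))) \<longlongrightarrow> 0) at_top" by simp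
  then show ?thesis
  proof (rule Lim_null_comparison[rotated])
    show "\<forall>\<^sub>F t in at_top. norm (of_real t ^ n * g j (\<alpha> * t)) \<le> K * (t ^ n * exp (- (\<alpha> * t)))"
      using eventually_gt_at_top[of 0]
    proof eventually_elim
      case (elim t)
      then have "\<alpha> * t \<ge> 0" using assms by auto
      have "t ^ n * norm (g j (\<alpha> * t)) \<le> t ^ n * (K * exp (- (\<alpha> * t)))"
        using elim K[OF \<open>\<alpha> * t \<ge> 0\<close>] by (intro mult_left_mono) auto
      then show ?case using elim by (simp add: norm_mult norm_power mult_ac)
    qed
  qed
qed

lemma moment_integral:
  assumes "\<alpha> > 0"
  shows "(LBINT t:{0<..}. of_real t ^ n * g (Suc n) (\<alpha> * t)) =
    (-1) ^ Suc n * fact n / of_real \<alpha> ^ Suc n * g 0 0"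
proof -
  have scaled: "((\<lambda>t. g j (\<alpha> * t)) has_vector_derivative of_real \<alpha> * g (Suc j) (\<alpha> * t)) (at t)" for j t
  proof -
    have "((\<lambda>t. \<alpha> * t) has_vector_derivative \<alpha>) (at t)" by (auto intro!: derivative_eq_intros)
    from vector_diff_chain_at[OF this deriv] show ?thesis by (simp add: o_def scaleR_conv_of_real)
  qed
  have pow: "((\<lambda>t. of_real t ^ Suc n) has_vector_derivative (of_nat (Suc n) :: complex) * of_real t ^ n) (at t)" for n and t :: real
    by (rule has_vector_derivative_real_field) (auto intro!: derivative_eq_intros simp del: power_Suc)
  \<comment> \<open>Integration by parts in the form of an explicit antiderivative: \<open>W\<close>
    vanishes at infinity, so the integral is minus its value at 0. In the induction step the moment
    and the derivative order rise together, and the surplus term is removed by subtracting a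
    multiple of the previous \<open>W\<close>.\<close>
  have "\<exists>W. (\<forall>t. (W has_vector_derivative of_real t ^ n * g (Suc n) (\<alpha> * t)) (at t)) \<and>
      (W \<longlongrightarrow> 0) at_top \<and> W 0 = (-1) ^ n * fact n / of_real \<alpha> ^ Suc n * g 0 0"
  proof (induction n)
    case 0
    have "((\<lambda>t. g 0 (\<alpha> * t) / of_real \<alpha>) \<longlongrightarrow> 0 / of_real \<alpha>) at_top"
      using moment_tendsto_0[OF assms, of 0 0] by (intro tendsto_divide) (use assms in auto)
    moreover have "((\<lambda>t. g 0 (\<alpha> * t) / of_real \<alpha>) has_vector_derivative g 1 (\<alpha> * t)) (at t)" for t
      using has_vector_derivative_divide[OF scaled[of 0 t], of "of_real \<alpha>"] assms by simp
    ultimately show ?case by (intro exI[of _ "\<lambda>t. g 0 (\<alpha> * t) / of_real \<alpha>"]) auto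
  next
    case (Suc n)
    then obtain W where W: "\<And>t. (W has_vector_derivative of_real t ^ n * g (Suc n) (\<alpha> * t)) (at t)"
      "(W \<longlongrightarrow> 0) at_top" "W 0 = (-1) ^ n * fact n / of_real \<alpha> ^ Suc n * g 0 0" by blast
    define V where "V = (\<lambda>t. (of_real t ^ Suc n * g (Suc n) (\<alpha> * t) - of_nat (Suc n) * W t) / of_real \<alpha>)"
    have "(V has_vector_derivative of_real t ^ Suc n * g (Suc (Suc n)) (\<alpha> * t)) (at t)" for t
    proof -
      have "(V has_vector_derivative (of_real t ^ Suc n * (of_real \<alpha> * g (Suc (Suc n)) (\<alpha> * t)) +
          of_nat (Suc n) * of_real t ^ n * g (Suc n) (\<alpha> * t) -
          of_nat (Suc n) * (of_real t ^ n * g (Suc n) (\<alpha> * t))) / of_real \<alpha>) (at t)"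
        unfolding V_def
        by (intro has_vector_derivative_divide has_vector_derivative_diff has_vector_derivative_mult
            has_vector_derivative_mult_right pow scaled W)
      then show ?thesis using assms by (simp add: algebra_simps)
    qed
    moreover have "(V \<longlongrightarrow> (0 - of_nat (Suc n) * 0) / of_real \<alpha>) at_top"
      unfolding V_def using assms by (intro tendsto_intros moment_tendsto_0 W(2)) auto
    moreover have "V 0 = (-1) ^ Suc n * fact (Suc n) / of_real \<alpha> ^ Suc (Suc n) * g 0 0"
      using assms by (simp add: V_def W(3) mult_ac)
    ultimately show ?case by (intro exI[of _ V]) auto
  qed
  then obtain W where W: "\<And>t. (W has_vector_derivative of_real t ^ n * g (Suc n) (\<alpha> * t)) (at t)"
    "(W \<longlongrightarrow> 0) at_top" "W 0 = (-1) ^ n * fact n / of_real \<alpha> ^ Suc n * g 0 0" by blast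
  have "(LBINT t=ereal 0..\<infinity>. of_real t ^ n * g (Suc n) (\<alpha> * t)) = 0 - W 0"
  proof (rule interval_integral_FTC_integrable)
    have "continuous_on UNIV (\<lambda>t. of_real t ^ n * g (Suc n) (\<alpha> * t))"
      by (intro continuous_intros continuous_scaled)
    then show "isCont (\<lambda>t. of_real t ^ n * g (Suc n) (\<alpha> * t)) x" for x
      by (simp add: continuous_on_eq_continuous_at)
    show "set_integrable lborel (einterval (ereal 0) \<infinity>) (\<lambda>t. of_real t ^ n * g (Suc n) (\<alpha> * t))"
      using set_integrable_moment[OF assms] by simp
    have "isCont W 0" using W(1)[of 0] by (rule has_vector_derivative_continuous)
    then show "((W \<circ> real_of_ereal) \<longlongrightarrow> W 0) (at_right (ereal 0))"
      by (simp only: ereal_tendsto_simps1) (simp add: isCont_def filterlim_at_split)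
    show "((W \<circ> real_of_ereal) \<longlongrightarrow> 0) (at_left \<infinity>)"
      using W(2) by (simp only: ereal_tendsto_simps1)
  qed (use W(1) in auto)
  then show ?thesis by (simp add: interval_integral_to_infinity_eq W(3))
qed

end

text \<open>The instance g_j(x) = (-1)^j exp (- x) of \<open>moment_integral\<close>, whose boundary
  value g_0(0) is 1.\<close>

lemma power_exp_integral:
  fixes \<alpha> :: real
  assumes "\<alpha> > 0"
  shows "(LBINT t:{0<..}. t ^ n * exp (- (\<alpha> * t))) = fact n / \<alpha> ^ Suc n"
proof -
  interpret decaying_derivatives "\<lambda>j x. of_real ((-1) ^ j * exp (- x))"
  proof
    show "\<exists>K. \<forall>x\<ge>0. norm (of_real ((-1) ^ j * exp (- x)) :: complex) \<le> K * exp (- x)" for j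
      by (intro exI[of _ 1]) (simp add: norm_mult norm_power)
    show "((\<lambda>x. of_real ((-1) ^ j * exp (- x))) has_vector_derivative of_real ((-1) ^ Suc j * exp (- x))) (at x)" for j x
      by (intro has_vector_derivative_of_real)
        (auto simp flip: has_real_derivative_iff_has_vector_derivative intro!: derivative_eq_intros)
  qed
  have "(LBINT t:{0<..}. of_real ((-1) ^ Suc n * (t ^ n * exp (- (\<alpha> * t))))) =
      (of_real ((-1) ^ Suc n * (fact n / \<alpha> ^ Suc n)) :: complex)"
    using moment_integral[OF assms, of n] by (simp add: mult_ac)
  then have "(LBINT t:{0<..}. (-1) ^ Suc n * (t ^ n * exp (- (\<alpha> * t)))) = (-1) ^ Suc n * (fact n / \<alpha> ^ Suc n)"
    unfolding set_integral_complex_of_real by (simp only: of_real_eq_iff)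
  then show ?thesis by (subst (asm) set_integral_mult_right, subst (asm) mult_cancel_left) simp
qed

lemma norm_diff_le_of_vector_derivative_bound:
  fixes h :: "real \<Rightarrow> 'a::real_normed_vector"
  assumes deriv: "\<And>z. z \<in> {x..y} \<Longrightarrow> (h has_vector_derivative h' z) (at z)"
    and bound: "\<And>z. z \<in> {x..y} \<Longrightarrow> norm (h' z) \<le> B" and "x \<le> y"
  shows "norm (h y - h x) \<le> B * (y - x)"
proof -
  have "norm (h y - h x) \<le> B * norm (y - x)"
  proof (rule differentiable_bound)
    fix z assume z: "z \<in> {x..y}"
    show "(h has_derivative (\<lambda>t. t *\<^sub>R h' z)) (at z within {x..y})"
      using deriv[OF z] unfolding has_vector_derivative_def by (rule has_derivative_at_withinI)
    show "onorm (\<lambda>t. t *\<^sub>R h' z) \<le> B"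
    proof (rule onorm_bound)
      show "0 \<le> B" using norm_ge_zero bound[OF z] by (rule order.trans)
      show "norm (t *\<^sub>R h' z) \<le> B * norm t" for t
        using mult_right_mono[OF bound[OF z], of "norm t"] by (simp add: mult.commute)
    qed
  qed (use \<open>x \<le> y\<close> in auto)
  then show ?thesis using \<open>x \<le> y\<close> by simp
qed

section \<open>Doubly periodic coefficients and integration in blocks\<close>

locale zero_mean_biperiodic =
  fixes f :: "nat \<Rightarrow> nat \<Rightarrow> complex" and c :: nat
  assumes c_pos: "c > 0"
    and periodic1: "f (r + c) s = f r s" and periodic2: "f r (s + c) = f r s"
    and f_0_left: "f 0 s = 0" and f_0_right: "f r 0 = 0"
    and zero_mean1: "(\<Sum>r<c. f r s) = 0" and zero_mean2: "(\<Sum>s<c. f r s) = 0"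

sublocale zero_mean_biperiodic \<subseteq> row: zero_mean_periodic "f r" c for r
  by unfold_locales (use c_pos periodic2 f_0_right zero_mean2 in auto)

context zero_mean_biperiodic
begin

definition g :: "nat \<Rightarrow> nat \<Rightarrow> real \<Rightarrow> complex" where
  "g r j x = (deriv ^^ j) (row.gen_fun r) (of_real x)"

sublocale dec: decaying_derivatives "g r" for r
proof
  show "(g r j has_vector_derivative g r (Suc j) x) (at x)" for j x
    using row.higher_deriv_gen_fun_has_derivative unfolding g_def .
  show "\<exists>K. \<forall>x\<ge>0. norm (g r j x) \<le> K * exp (- x)" for j
    using row.higher_deriv_gen_fun_bound unfolding g_def by blast
qed

lemma g_sums: "x > 0 \<Longrightarrow> (\<lambda>s. f r s * (- of_nat s) ^ j * exp (- of_real x) ^ s) sums g r j x"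
  unfolding g_def by (rule row.higher_deriv_gen_fun_sums) simp

lemma g_0: "g r 0 0 = - (\<Sum>s<c. of_nat s * f r s) / of_nat c"
  by (simp add: g_def row.gen_fun_0)

lemma g_periodic: "g (r + m * c) = g r"
proof -
  have "f (r + m * c) = f r"
  proof (induction m)
    case (Suc m)
    have "f (r + Suc m * c) = f ((r + m * c) + c)" by (simp add: algebra_simps)
    also have "\<dots> = f (r + m * c)" by (rule ext) (rule periodic1)
    finally show ?case using Suc by simp
  qed simp
  then show ?thesis by (simp add: g_def[abs_def])
qed

lemma g_row_0: "g 0 j x = 0"
proof -
  have "f 0 = (\<lambda>_. 0)" by (simp add: fun_eq_iff f_0_left)
  moreover have "row.gen_fun 0 = (\<lambda>_. 0)" by (simp add: fun_eq_iff row.gen_fun_def f_0_left)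
  ultimately show ?thesis by (simp add: g_def)
qed

text \<open>Mean zero in the first variable kills the series coefficient by coefficient. The block
  estimate compares with this sum, in which all rows are evaluated at one common point.\<close>

lemma g_sum_eq_0:
  assumes "x > 0"
  shows "(\<Sum>r<c. g r j x) = 0"
proof -
  have "(\<lambda>s. \<Sum>r<c. f r s * (- of_nat s) ^ j * exp (- of_real x) ^ s) sums (\<Sum>r<c. g r j x)"
    by (intro sums_sum g_sums assms)
  also have "(\<lambda>s. \<Sum>r<c. f r s * (- of_nat s) ^ j * exp (- of_real x) ^ s) = (\<lambda>_. 0)"
    by (simp add: sum_distrib_right[symmetric] zero_mean1)
  finally show ?thesis using sums_unique2[OF sums_zero] by metis
qed

text \<open>By periodicity only c different rows occur, so the sum of their constants serves them
  all.\<close>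

lemma g_uniform_decay: "\<exists>K>0. \<forall>r. \<forall>x\<ge>0. norm (g r j x) \<le> K * exp (- x)"
proof -
  have "\<forall>r. \<exists>K>0. \<forall>x\<ge>0. norm (g r j x) \<le> K * exp (- x)"
    using row.higher_deriv_gen_fun_bound unfolding g_def by blast
  from choice[OF this] obtain K where K: "\<And>r. K r > 0" "\<And>r x. x \<ge> 0 \<Longrightarrow> norm (g r j x) \<le> K r * exp (- x)"
    by blast
  have "norm (g r j x) \<le> (\<Sum>r<c. K r) * exp (- x)" if "x \<ge> 0" for r x
  proof -
    have "g r = g (r mod c)" using g_periodic[of "r mod c" "r div c"] by simp
    then have "norm (g r j x) \<le> K (r mod c) * exp (- x)" using K(2)[OF that, of "r mod c"] by simp
    also have "K (r mod c) \<le> (\<Sum>r<c. K r)" using c_pos less_imp_le[OF K(1)] by (intro member_le_sum) auto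
    finally show ?thesis by (simp add: mult_right_mono)
  qed
  moreover have "(\<Sum>r<c. K r) > 0" using c_pos K(1) by (intro sum_pos) auto
  ultimately show ?thesis by blast
qed

text \<open>Collects the indices A = r + m c with r < c; by periodicity \<open>g r\<close> stands
  for \<open>g (r + m * c)\<close>.\<close>

definition block :: "nat \<Rightarrow> nat \<Rightarrow> real \<Rightarrow> complex" where
  "block n m t = (\<Sum>r<c. of_real t ^ n * g r (Suc n) (2 * pi * real (r + m * c) * t))"

lemma set_integrable_term:
  "set_integrable lborel {0<..} (\<lambda>t. of_real t ^ n * g r (Suc n) (2 * pi * real (r + m * c) * t))"
\<comment> \<open>At the index A = 0 the scale 2 pi A degenerates, but row 0 vanishes
  identically.\<close>
proof (cases "r + m * c = 0")
  case True
  then have "r = 0" by simp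
  then show ?thesis by (simp add: g_row_0 set_integrable_def)
next
  case False
  then have "real (r + m * c) > 0" by (simp only: of_nat_0_less_iff)
  then show ?thesis by (intro dec.set_integrable_moment mult_pos_pos pi_gt_zero) auto
qed

lemma term_integral:
  "(LBINT t:{0<..}. of_real t ^ n * g r (Suc n) (2 * pi * real (r + m * c) * t)) =
    (-1) ^ Suc n * fact n / (2 * of_real pi * of_nat (r + m * c)) ^ Suc n * g r 0 0"
proof (cases "r + m * c = 0")
  case True
  then have "r = 0" by simp
  then show ?thesis by (simp add: g_row_0)
next
  case False
  then have "real (r + m * c) > 0" by (simp only: of_nat_0_less_iff)
  then have "2 * pi * real (r + m * c) > 0" by (intro mult_pos_pos pi_gt_zero) auto
  from dec.moment_integral[OF this, of n r] show ?thesis by simp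
qed

lemma set_integrable_block: "set_integrable lborel {0<..} (block n m)"
  unfolding block_def[abs_def] set_integrable_def scaleR_sum_right
  by (rule Bochner_Integration.integrable_sum) (rule set_integrable_term[unfolded set_integrable_def])

lemma block_integral:
  "(LBINT t:{0<..}. block n m t) =
    (\<Sum>r<c. (-1) ^ Suc n * fact n / (2 * of_real pi * of_nat (r + m * c)) ^ Suc n * g r 0 0)"
proof -
  have "(LBINT t:{0<..}. block n m t) =
      (\<Sum>r<c. LBINT t:{0<..}. of_real t ^ n * g r (Suc n) (2 * pi * real (r + m * c) * t))"
    unfolding block_def[abs_def] set_lebesgue_integral_def scaleR_sum_right
    by (rule Bochner_Integration.integral_sum) (rule set_integrable_term[unfolded set_integrable_def])
  then show ?thesis by (simp only: term_integral)
qed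

text \<open>Within a block the values at \<open>2 \<pi> m c t\<close> cancel, so only the variation of \<open>g\<close> over the
  block contributes, which gains a factor \<open>1 / m\<close> after integration.\<close>
lemma block_bound:
  "\<exists>C. \<forall>m\<ge>1. \<forall>t>0. norm (block n m t) \<le> C * (t ^ Suc n * exp (- (2 * pi * real (m * c) * t)))"
proof -
  obtain K where K: "K > 0" "\<And>r x. x \<ge> 0 \<Longrightarrow> norm (g r (Suc (Suc n)) x) \<le> K * exp (- x)"
    using g_uniform_decay[of "Suc (Suc n)"] by blast
  have "norm (block n m t) \<le> (real c * (K * (2 * pi * real c))) * (t ^ Suc n * exp (- (2 * pi * real (m * c) * t)))"
    if "m \<ge> 1" "t > 0" for m t
  proof -
    define x where "x = 2 * pi * real (m * c) * t"
    have "x > 0" unfolding x_def using that c_pos by simp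
    have diff: "norm (g r (Suc n) (2 * pi * real (r + m * c) * t) - g r (Suc n) x) \<le>
        K * exp (- x) * (2 * pi * real c * t)" if "r < c" for r
    proof -
      let ?y = "2 * pi * real (r + m * c) * t"
      have y: "?y - x = 2 * pi * real r * t" unfolding x_def by (simp add: algebra_simps)
      have le: "x \<le> ?y" using y \<open>t > 0\<close> by (simp add: algebra_simps)
      have "norm (g r (Suc n) ?y - g r (Suc n) x) \<le> K * exp (- x) * (?y - x)"
      proof (rule norm_diff_le_of_vector_derivative_bound[OF dec.deriv _ le])
        fix z assume "z \<in> {x..?y}"
        then have "norm (g r (Suc (Suc n)) z) \<le> K * exp (- z)" using \<open>x > 0\<close> by (intro K(2)) auto
        also have "\<dots> \<le> K * exp (- x)" using \<open>z \<in> _\<close> K(1) by (intro mult_left_mono) auto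
        finally show "norm (g r (Suc (Suc n)) z) \<le> K * exp (- x)" .
      qed
      also have "\<dots> \<le> K * exp (- x) * (2 * pi * real c * t)"
        unfolding y using that K(1) \<open>t > 0\<close> by (intro mult_left_mono mult_right_mono) auto
      finally show ?thesis .
    qed
    have "block n m t = of_real t ^ n * ((\<Sum>r<c. g r (Suc n) (2 * pi * real (r + m * c) * t)) - (\<Sum>r<c. g r (Suc n) x))"
      using g_sum_eq_0[OF \<open>x > 0\<close>] by (simp add: block_def sum_distrib_left)
    also have "\<dots> = of_real t ^ n * (\<Sum>r<c. g r (Suc n) (2 * pi * real (r + m * c) * t) - g r (Suc n) x)"
      by (simp only: sum_subtractf)
    also have "norm \<dots> \<le> t ^ n * (\<Sum>r<c. K * exp (- x) * (2 * pi * real c * t))"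
      unfolding norm_mult norm_power using \<open>t > 0\<close>
      by (intro mult_mono power_mono sum_norm_le diff) (auto intro!: sum_nonneg simp: less_imp_le[OF K(1)])
    also have "\<dots> = (real c * (K * (2 * pi * real c))) * (t ^ Suc n * exp (- x))"
      by simp
    finally show ?thesis unfolding x_def .
  qed
  then show ?thesis by blast
qed

text \<open>The extra power of t in \<open>block_bound\<close> raises the decay in m from order n +
  1 to order n + 2, which is at least 2 even for n = 0. The bound starts at m = 1, since for m = 0
  its exponential is constant.\<close>

lemma summable_block_integral_norm:
  "summable (\<lambda>m. LBINT t:{0<..}. norm (block n m t))"
proof -
  obtain C where C: "\<And>m t. m \<ge> 1 \<Longrightarrow> t > 0 \<Longrightarrow>
      norm (block n m t) \<le> C * (t ^ Suc n * exp (- (2 * pi * real (m * c) * t)))"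
    using block_bound[of n] by blast
  let ?D = "\<bar>C * fact (Suc n) / (2 * pi * real c) ^ Suc (Suc n)\<bar>"
  have "summable (\<lambda>m. ?D * (1 / real m ^ 2))"
    using inverse_power_summable[of 2, where ?'a = real] by (intro summable_mult) (simp add: field_simps)
  then show ?thesis
  proof (rule summable_comparison_test'[of _ 1])
    fix m :: nat assume m: "m \<ge> 1"
    let ?\<alpha> = "2 * pi * real (m * c)"
    have \<alpha>: "?\<alpha> > 0" using m c_pos by simp
    have "(LBINT t:{0<..}. norm (block n m t)) \<le> (LBINT t:{0<..}. C * (t ^ Suc n * exp (- (?\<alpha> * t))))"
    proof (rule set_integral_mono)
      show "set_integrable lborel {0<..} (\<lambda>t. norm (block n m t))"
        by (rule set_integrable_norm[OF set_integrable_block])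
      show "set_integrable lborel {0<..} (\<lambda>t. C * (t ^ Suc n * exp (- (?\<alpha> * t))))"
        by (rule set_integrable_mult_right[OF set_integrable_power_exp[OF \<alpha>]])
      show "norm (block n m t) \<le> C * (t ^ Suc n * exp (- (?\<alpha> * t)))" if "t \<in> {0<..}" for t
        using C[OF m] that by (simp only: greaterThan_iff)
    qed
    also have "\<dots> = C * (fact (Suc n) / ?\<alpha> ^ Suc (Suc n))"
      by (subst set_integral_mult_right) (simp only: power_exp_integral[OF \<alpha>])
    also have "\<dots> = C * fact (Suc n) / (2 * pi * real c) ^ Suc (Suc n) * (1 / real m ^ Suc (Suc n))"
      by (simp add: power_mult_distrib mult_ac)
    also have "\<dots> \<le> ?D * (1 / real m ^ Suc (Suc n))"
      by (intro mult_right_mono abs_ge_self) simp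
    also have "\<dots> \<le> ?D * (1 / real m ^ 2)"
    proof -
      have "real m ^ 2 \<le> real m ^ Suc (Suc n)" using m by (intro power_increasing) auto
      then have "1 / real m ^ Suc (Suc n) \<le> 1 / real m ^ 2" using m by (intro frac_le) auto
      then show ?thesis by (rule mult_left_mono) (rule abs_ge_zero)
    qed
    finally have "(LBINT t:{0<..}. norm (block n m t)) \<le> ?D * (1 / real m ^ 2)" .
    moreover have "(LBINT t:{0<..}. norm (block n m t)) \<ge> 0"
      unfolding set_lebesgue_integral_def by (intro Bochner_Integration.integral_nonneg) simp
    ultimately show "norm (LBINT t:{0<..}. norm (block n m t)) \<le> ?D * (1 / real m ^ 2)"
      by (simp only: real_norm_def abs_of_nonneg)
  qed
qed

text \<open>For fixed t the terms are dominated by a geometric series with ratio exp (- 2 pi t). The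
  ratio tends to 1 as t tends to 0, so this is a pointwise statement only.\<close>

lemma summable_norm_terms:
  assumes "t > 0"
  shows "summable (\<lambda>A. norm (of_real t ^ n * g A (Suc n) (2 * pi * real A * t)))"
proof -
  obtain K where K: "\<And>r x. x \<ge> 0 \<Longrightarrow> norm (g r (Suc n) x) \<le> K * exp (- x)"
    using g_uniform_decay[of "Suc n"] by blast
  have "summable (\<lambda>A. t ^ n * K * exp (- (2 * pi * t)) ^ A)"
    using assms by (intro summable_mult summable_geometric) simp
  then show ?thesis
  proof (rule summable_comparison_test')
    fix A :: nat
    have "norm (g A (Suc n) (2 * pi * real A * t)) \<le> K * exp (- (2 * pi * real A * t))"
      using assms by (intro K) auto
    also have "exp (- (2 * pi * real A * t)) = exp (- (2 * pi * t)) ^ A"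
      by (simp add: exp_of_nat_mult[symmetric] mult_ac)
    finally show "norm (norm (of_real t ^ n * g A (Suc n) (2 * pi * real A * t))) \<le> t ^ n * K * exp (- (2 * pi * t)) ^ A"
      using assms by (simp add: norm_mult norm_power mult_left_mono mult.assoc)
  qed
qed

lemma block_eq: "block n m t = (\<Sum>A\<in>{m * c..<m * c + c}. of_real t ^ n * g A (Suc n) (2 * pi * real A * t))"
proof -
  have "(\<Sum>A\<in>{m * c..<m * c + c}. of_real t ^ n * g A (Suc n) (2 * pi * real A * t)) =
      (\<Sum>r\<in>{0..<c}. of_real t ^ n * g (r + m * c) (Suc n) (2 * pi * real (r + m * c) * t))"
    using sum.shift_bounds_nat_ivl[of "\<lambda>A. of_real t ^ n * g A (Suc n) (2 * pi * real A * t)" 0 "m * c" c]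
    by (simp add: add.commute)
  then show ?thesis by (simp only: block_def g_periodic lessThan_atLeast0)
qed

text \<open>Summable L1 norms of the blocks permit the exchange of sum and integral; grouping into
  blocks is harmless pointwise because the terms converge absolutely for each t.\<close>

theorem moment_integral_sums:
  assumes F: "\<And>t. t > 0 \<Longrightarrow> F t = (\<Sum>A. of_real t ^ n * g A (Suc n) (2 * pi * real A * t))"
  shows "(\<lambda>m. \<Sum>r<c. (-1) ^ Suc n * fact n / (2 * of_real pi * of_nat (r + m * c)) ^ Suc n * g r 0 0)
      sums integral {0<..} F"
proof -
  have blocks: "(\<lambda>m. block n m t) sums F t" if "t > 0" for t
    unfolding F[OF that] block_eq
    by (intro sums_group summable_sums c_pos summable_norm_cancel[OF summable_norm_terms] that)
  have abs_blocks: "summable (\<lambda>m. norm (block n m t))" if "t > 0" for t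
  proof (rule summable_comparison_test')
    show "summable (\<lambda>m. \<Sum>A\<in>{m * c..<m * c + c}. norm (of_real t ^ n * g A (Suc n) (2 * pi * real A * t)))"
      using sums_group[OF summable_sums[OF summable_norm_terms[OF that, of n]] c_pos] by (rule sums_summable)
    show "norm (norm (block n m t)) \<le> (\<Sum>A\<in>{m * c..<m * c + c}. norm (of_real t ^ n * g A (Suc n) (2 * pi * real A * t)))" for m
      unfolding block_eq real_norm_def abs_norm_cancel by (rule norm_sum)
  qed
  let ?h = "\<lambda>m t. indicator {0<..} t *\<^sub>R block n m t"
  have int: "integrable lborel (?h m)" for m
    using set_integrable_block[of n m] by (simp add: set_integrable_def)
  have ae: "AE t in lborel. summable (\<lambda>m. norm (?h m t))"
    using abs_blocks by (intro AE_I2) (auto simp: indicator_def)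
  have norms: "summable (\<lambda>m. \<integral>t. norm (?h m t) \<partial>lborel)"
  proof -
    have "norm (?h m t) = indicator {0<..} t *\<^sub>R norm (block n m t)" for m t by (simp add: indicator_def)
    then show ?thesis using summable_block_integral_norm[of n] by (simp add: set_lebesgue_integral_def)
  qed
  have suminf_h: "(\<Sum>m. ?h m t) = indicator {0<..} t *\<^sub>R F t" for t
    using sums_unique[OF blocks[of t]] by (auto simp: indicator_def)
  \<comment> \<open>The goal speaks of the gauge integral; Lebesgue integrability of
    \<open>F\<close> identifies it with the Lebesgue integral.\<close>
  have "set_integrable lborel {0<..} F"
    using integrable_suminf[OF int ae norms] unfolding suminf_h set_integrable_def .
  from set_borel_integral_eq_integral(2)[OF this]
  have "integral {0<..} F = (\<integral>t. indicator {0<..} t *\<^sub>R F t \<partial>lborel)"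
    by (simp add: set_lebesgue_integral_def)
  moreover have "(\<lambda>m. LBINT t:{0<..}. block n m t) sums (\<integral>t. indicator {0<..} t *\<^sub>R F t \<partial>lborel)"
    using sums_integral[OF int ae norms] unfolding suminf_h set_lebesgue_integral_def .
  ultimately show ?thesis by (simp only: block_integral)
qed

end

section \<open>Eisenstein series above a cusp\<close>

lemma has_sum_atLeast_1_imp_sums:
  fixes h :: "nat \<Rightarrow> 'a::{comm_monoid_add,t2_space}"
  assumes "(h has_sum S) {1..}"
  shows "(\<lambda>n. h (Suc n)) sums S"
proof -
  have "range Suc = {1..}" by (auto simp: greaterThan_0[symmetric])
  then have "((h \<circ> Suc) has_sum S) UNIV"
    using assms has_sum_reindex[of Suc UNIV h S] by simp
  from has_sum_imp_sums[OF this] show ?thesis by (simp add: o_def)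
qed

text \<open>An absolutely summable family of pairs may be summed by rows or along the hyperbolas A B
  = N; the latter produces the divisor sums of the Eisenstein coefficients.\<close>

lemma divisor_sum_rearrange:
  fixes u :: "nat \<times> nat \<Rightarrow> complex"
  assumes summable: "(\<lambda>p. norm (u p)) summable_on {1..} \<times> {1..}"
    and inner: "\<And>A. A \<ge> 1 \<Longrightarrow> (\<lambda>n. u (A, Suc n)) sums v A"
  shows "(\<lambda>n. v (Suc n)) sums (\<Sum>n. \<Sum>A | A dvd Suc n. u (A, Suc n div A))"
proof -
  let ?P = "{1::nat..}"
  have u: "u summable_on ?P \<times> ?P" using summable by (rule abs_summable_summable)
  then obtain S where S: "(u has_sum S) (?P \<times> ?P)" by (auto simp: summable_on_def)
  have "((\<lambda>B. u (A, B)) has_sum v A) ?P" if "A \<in> ?P" for A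
  proof -
    have "(\<lambda>B. u (A, B)) summable_on ?P"
      using summable_on_SigmaD1[of "\<lambda>A B. u (A, B)" ?P "\<lambda>_. ?P" A] u that by simp
    then obtain S' where "((\<lambda>B. u (A, B)) has_sum S') ?P" by (auto simp: summable_on_def)
    moreover from has_sum_atLeast_1_imp_sums[OF this] have "S' = v A"
      using inner[of A] that by (auto dest: sums_unique2)
    ultimately show ?thesis by simp
  qed
  from has_sum_SigmaD[OF S this] have 1: "(\<lambda>n. v (Suc n)) sums S"
    by (rule has_sum_atLeast_1_imp_sums)
  have bij: "bij_betw (\<lambda>(N, A). (A, N div A)) (SIGMA N:?P. {A. A dvd N}) (?P \<times> ?P)"
    by (rule bij_betwI[where g = "\<lambda>(A, B). (A * B, A)"])
      (auto simp: Suc_le_eq dvd_div_eq_0_iff intro: Nat.gr0I elim!: dvdE)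
  have "((\<lambda>(N, A). u (A, N div A)) has_sum S) (SIGMA N:?P. {A. A dvd N})"
    using has_sum_reindex_bij_betw[OF bij, of u S] S by (simp add: case_prod_unfold)
  then have "((\<lambda>N. \<Sum>A | A dvd N. u (A, N div A)) has_sum S) ?P"
  proof (rule has_sum_SigmaD)
    fix N :: nat assume "N \<in> ?P"
    then have "finite {A. A dvd N}" by (intro finite_divisors_nat) auto
    then show "((\<lambda>A. case (N, A) of (N, A) \<Rightarrow> u (A, N div A)) has_sum (\<Sum>A | A dvd N. u (A, N div A))) {A. A dvd N}"
      by (simp add: has_sum_finite)
  qed
  from has_sum_atLeast_1_imp_sums[OF this]
  have "(\<Sum>n. \<Sum>A | A dvd Suc n. u (A, Suc n div A)) = S" by (rule sums_unique[symmetric])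
  with 1 show ?thesis by simp
qed

text \<open>For A, B \<ge> 1 one has A + B \<le> A B + 1, so x^(A B) is at most x^A x^B / x, and a
  product of two single series is a majorant.\<close>

lemma abs_summable_on_lambert:
  fixes h :: "nat \<Rightarrow> nat \<Rightarrow> complex" and x :: real
  assumes x: "0 < x" "x < 1" and h: "\<And>A B. norm (h A B) \<le> 1"
  shows "(\<lambda>p. norm (case p of (A, B) \<Rightarrow> h A B * of_nat B ^ j * of_real x ^ (A * B))) summable_on {1..} \<times> {1..}"
proof (rule Infinite_Sum.abs_summable_on_comparison_test)
  let ?P = "{1::nat..}"
  have q: "(\<lambda>B. real B ^ j * x ^ B) summable_on UNIV"
  proof (rule norm_summable_imp_summable_on)
    define b where "b = - ln x"
    have b: "b > 0" "x = exp (- b)" using x by (auto simp: b_def)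
    have "(\<lambda>B. real B ^ j * exp (- b * real B)) \<in> O(\<lambda>B. exp (- b / 2 * real B))"
      using b(1) by real_asymp
    then have "(\<lambda>B. real B ^ j * x ^ B) \<in> O(\<lambda>B. exp (- b / 2) ^ B)"
      by (simp add: b(2) exp_of_nat2_mult[symmetric])
    moreover have "summable (\<lambda>B. norm (exp (- b / 2) ^ B))"
      using b(1) by (simp add: norm_power summable_geometric)
    ultimately have "summable (\<lambda>B. real B ^ j * x ^ B)" by (rule summable_comparison_test_bigo[rotated])
    then show "summable (\<lambda>B. norm (real B ^ j * x ^ B))"
      using x by (simp add: abs_mult)
  qed
  have p: "(\<lambda>A. x ^ A) summable_on UNIV"
    using x by (intro norm_summable_imp_summable_on) (simp add: norm_power summable_geometric)
  have "(\<lambda>(A, B). x ^ A / x * (real B ^ j * x ^ B)) summable_on ?P \<times> ?P"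
  proof (rule summable_on_SigmaI)
    show "((\<lambda>B. case (A, B) of (A, B) \<Rightarrow> x ^ A / x * (real B ^ j * x ^ B)) has_sum
        (x ^ A / x * (\<Sum>\<^sub>\<infinity>B\<in>?P. real B ^ j * x ^ B))) ?P" for A
      unfolding prod.case by (rule has_sum_cmult_right, rule has_sum_infsum, rule summable_on_subset[OF q]) simp
    have "(\<lambda>A. x ^ A * ((\<Sum>\<^sub>\<infinity>B\<in>?P. real B ^ j * x ^ B) / x)) summable_on ?P"
      by (rule summable_on_cmult_left[OF summable_on_subset[OF p]]) auto
    then show "(\<lambda>A. x ^ A / x * (\<Sum>\<^sub>\<infinity>B\<in>?P. real B ^ j * x ^ B)) summable_on ?P"
      by (simp add: mult_ac)
  qed (use x in auto)
  then show "(\<lambda>p. norm (case p of (A, B) \<Rightarrow> x ^ A / x * (real B ^ j * x ^ B))) summable_on ?P \<times> ?P"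
    using x by (subst summable_on_iff_abs_summable_on_real[symmetric])
  fix AB assume "AB \<in> ?P \<times> ?P"
  then obtain A B where AB: "AB = (A, B)" "A \<ge> 1" "B \<ge> 1" by auto
  then have "A + B \<le> Suc (A * B)"
    using mult_le_mono[of 1 A 1 B] by (cases A; cases B) auto
  then have "x ^ Suc (A * B) \<le> x ^ (A + B)" using x by (intro power_decreasing) auto
  then have "x ^ (A * B) \<le> x ^ A / x * x ^ B" using x by (simp add: power_add field_simps)
  then have "norm (h A B) * (real B ^ j * x ^ (A * B)) \<le> 1 * (real B ^ j * (x ^ A / x * x ^ B))"
    using x by (intro mult_mono h mult_left_mono) auto
  then show "norm (case AB of (A, B) \<Rightarrow> h A B * of_nat B ^ j * of_real x ^ (A * B)) \<le>
      norm (case AB of (A, B) \<Rightarrow> x ^ A / x * (real B ^ j * x ^ B))"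
    using x by (simp add: AB norm_mult norm_power abs_mult mult_ac)
qed

lemma sum_int_lessThan: "(\<Sum>s\<in>{0..<int c}. h s) = (\<Sum>s<c. h (int s))"
  using sum.reindex[of int "{0..<c}" h] by (simp add: image_int_atLeastLessThan lessThan_atLeast0)

section \<open>The coefficient array at the cusp a/c\<close>

locale eisenstein_cusp =
  fixes q1 q2 :: nat and chi1 chi2 :: "int \<Rightarrow> complex" and a :: int and c :: nat
  assumes chi1: "dirichlet_char q1 chi1" "q1 > 1" and chi2: "dirichlet_char q2 chi2" "q2 > 1"
    and coprime_ac: "coprime a (int c)" and level: "q1 * q2 dvd c" and c_pos: "c > 0"
begin

text \<open>The coefficient of the pair (A, B), apart from the power of B: the real part a/c of z is
  absorbed as a root of unity.\<close>

definition twist :: "nat \<Rightarrow> nat \<Rightarrow> complex" where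
  "twist r s = chi1 (int r) * cnj (chi2 (int s)) * expi (of_int (a * int r * int s) / of_nat c)"

lemma expi_add_c: "expi (of_int (m + n * int c) / of_nat c) = expi (of_int m / of_nat c)"
proof -
  have "of_int (m + n * int c) / of_nat c = of_int m / of_nat c + (of_int n :: complex)"
    using c_pos by (simp add: field_simps)
  then show ?thesis by (simp only: expi_add_of_int)
qed

lemma chi_add_c: "chi1 (m + int c) = chi1 m" "chi2 (m + int c) = chi2 m"
proof -
  obtain l where l: "int c = int q1 * int q2 * l" using level by (metis dvdE of_nat_mult)
  show "chi1 (m + int c) = chi1 m"
    using dirichlet_charD(3)[OF chi1(1)] by (rule periodic_cong) (simp add: l)
  show "chi2 (m + int c) = chi2 m"
    using dirichlet_charD(3)[OF chi2(1)] by (rule periodic_cong) (simp add: l)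
qed

lemma q_dvd_c: "int q1 dvd int c" "int q2 dvd int c"
  using level by (auto elim!: dvdE)

text \<open>Otherwise q1 would divide a r, although a and r are both prime to q1 > 1. This is the
  hypothesis of \<open>char_sum_twist_zero\<close> that gives mean zero in the second variable;
  \<open>not_c_dvd'\<close> serves the first.\<close>

lemma not_c_dvd:
  assumes "chi1 r \<noteq> 0"
  shows "\<not> int c dvd a * r * int q2"
proof
  assume "int c dvd a * r * int q2"
  then have "int q1 * int q2 dvd a * r * int q2"
    using level by (metis dvd_trans of_nat_dvd_iff of_nat_mult)
  then have "int q1 dvd a * r" using chi2(2) by simp
  moreover have "coprime (a * r) (int q1)"
    using assms dirichlet_charD(4)[OF chi1(1)] coprime_ac q_dvd_c(1)
    by (meson coprime_divisors coprime_mult_left_iff dvd_refl)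
  ultimately have "is_unit (int q1)" by (meson coprime_absorb_right)
  then show False using chi1(2) by simp
qed

lemma not_c_dvd':
  assumes "chi2 s \<noteq> 0"
  shows "\<not> int c dvd a * s * int q1"
proof
  assume "int c dvd a * s * int q1"
  then have "int q1 * int q2 dvd int q1 * (a * s)"
    using level by (metis dvd_trans of_nat_dvd_iff of_nat_mult mult.commute)
  then have "int q2 dvd a * s" using chi1(2) by simp
  moreover have "coprime (a * s) (int q2)"
    using assms dirichlet_charD(4)[OF chi2(1)] coprime_ac q_dvd_c(2)
    by (meson coprime_divisors coprime_mult_left_iff dvd_refl)
  ultimately have "is_unit (int q2)" by (meson coprime_absorb_right)
  then show False using chi2(2) by simp
qed

sublocale zero_mean_biperiodic twist c
proof
  show "c > 0" by (rule c_pos)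
  show "twist (r + c) s = twist r s" for r s
    using expi_add_c[of "a * int r * int s" "a * int s"] chi_add_c(1)[of "int r"]
    by (simp add: twist_def algebra_simps)
  show "twist r (s + c) = twist r s" for r s
    using expi_add_c[of "a * int r * int s" "a * int r"] chi_add_c(2)[of "int s"]
    by (simp add: twist_def algebra_simps)
  show "twist 0 s = 0" for s by (simp add: twist_def dirichlet_char_0[OF chi1])
  show "twist r 0 = 0" for r by (simp add: twist_def dirichlet_char_0[OF chi2])
  show "(\<Sum>r<c. twist r s) = 0" for s
  proof (cases "chi2 (int s) = 0")
    case False
    have "(\<Sum>r<c. twist r s) = cnj (chi2 (int s)) *
        (\<Sum>r\<in>{0..<int c}. chi1 r * expi (of_int (a * int s * r) / of_int (int c)))"
      unfolding sum_int_lessThan sum_distrib_left by (simp add: twist_def mult_ac)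
    then show ?thesis
      using char_sum_twist_zero[OF chi1(1) q_dvd_c(1), of "a * int s"] not_c_dvd'[OF False] c_pos by simp
  qed (simp add: twist_def)
  show "(\<Sum>s<c. twist r s) = 0" for r
  proof (cases "chi1 (int r) = 0")
    case False
    have "(\<Sum>s<c. twist r s) = chi1 (int r) *
        (\<Sum>s\<in>{0..<int c}. cnj (chi2 s) * expi (of_int (a * int r * s) / of_int (int c)))"
      unfolding sum_int_lessThan sum_distrib_left by (simp add: twist_def mult_ac)
    then show ?thesis
      using char_sum_twist_zero[OF dirichlet_char_cnj[OF chi2(1)] q_dvd_c(2), of "a * int r"]
        not_c_dvd[OF False] c_pos by simp
  qed (simp add: twist_def)
qed

text \<open>Summing over B first turns B^(k-1) exp (- 2 pi A B t) into a derivative of order k - 1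
  of the row function; the sign comes from differentiating exp (- B u) that often.\<close>

lemma eisenstein_eq_suminf_g:
  assumes "t > 0"
  shows "eisenstein chi1 chi2 k (of_int a / of_nat c + \<i> * of_real t) =
    2 * (-1) ^ (k - 1) * (\<Sum>A. g A (k - 1) (2 * pi * real A * t))"
proof -
  define z where "z = of_int a / of_nat c + \<i> * of_real t"
  define x where "x = exp (- (2 * pi * t))"
  define u where "u = (\<lambda>(A, B). twist A B * of_nat B ^ (k - 1) * of_real x ^ (A * B))"
  have x: "0 < x" "x < 1" using assms by (auto simp: x_def)
  have expi_z: "expi (of_nat (A * B) * z) = expi (of_int (a * int A * int B) / of_nat c) * of_real x ^ (A * B)" for A B
  proof -
    have "of_nat (A * B) * z = of_int (a * int A * int B) / of_nat c + of_nat (A * B) * (\<i> * of_real t)"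
      by (simp add: z_def algebra_simps)
    moreover have "expi (\<i> * of_real t) = of_real x"
    proof -
      have "2 * of_real pi * \<i> * (\<i> * of_real t) = complex_of_real (- (2 * pi * t))" by (simp add: algebra_simps)
      then show ?thesis unfolding expi_def x_def by (simp only: exp_of_real)
    qed
    ultimately show ?thesis by (simp only: expi_add expi_power[symmetric])
  qed
  have "norm (twist A B) \<le> 1" for A B
  proof -
    have "norm (expi (of_int (a * int A * int B) / of_nat c)) = 1"
      using norm_expi_frac[of "a * int A * int B" "int c"] by simp
    moreover have "norm (chi1 (int A)) * norm (chi2 (int B)) \<le> 1 * 1"
      by (intro mult_mono dirichlet_char_norm_le[OF chi1(1)] dirichlet_char_norm_le[OF chi2(1)]) auto
    ultimately show ?thesis by (simp add: twist_def norm_mult)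
  qed
  then have summable: "(\<lambda>p. norm (u p)) summable_on {1..} \<times> {1..}"
    unfolding u_def by (intro abs_summable_on_lambert x)
  have "(\<lambda>n. u (A, Suc n)) sums ((-1) ^ (k - 1) * g A (k - 1) (2 * pi * real A * t))" if "A \<ge> 1" for A
  proof -
    have "2 * pi * real A * t > 0" using that assms by simp
    from g_sums[OF this, of A "k - 1"]
    have "(\<lambda>s. (-1) ^ (k - 1) * (twist A s * (- of_nat s) ^ (k - 1) * exp (- of_real (2 * pi * real A * t)) ^ s)) sums
        ((-1) ^ (k - 1) * g A (k - 1) (2 * pi * real A * t))" by (rule sums_mult)
    moreover have "(-1) ^ (k - 1) * (twist A s * (- of_nat s) ^ (k - 1) * exp (- of_real (2 * pi * real A * t)) ^ s) = u (A, s)" for s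
    proof -
      have "exp (- of_real (2 * pi * real A * t)) = (of_real (x ^ A) :: complex)"
        unfolding x_def exp_of_nat_mult[symmetric] exp_of_real of_real_minus[symmetric] by (simp add: mult_ac)
      moreover have "(-1) ^ (k - 1) * (- of_nat s) ^ (k - 1) = (of_nat s ^ (k - 1) :: complex)"
        by (simp add: power_mult_distrib[symmetric])
      moreover have "y * (T * N * X) = T * (y * N) * X" for y T N X :: complex by (simp only: mult_ac)
      ultimately show ?thesis by (simp add: u_def power_mult)
    qed
    ultimately have "(\<lambda>s. u (A, s)) sums ((-1) ^ (k - 1) * g A (k - 1) (2 * pi * real A * t))" by simp
    moreover have "u (A, 0) = 0" by (simp add: u_def f_0_right)
    ultimately show ?thesis by (subst sums_Suc_iff) simp
  qed
  from divisor_sum_rearrange[OF summable this]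
  have "(\<lambda>n. (-1) ^ (k - 1) * g (Suc n) (k - 1) (2 * pi * real (Suc n) * t)) sums
      (\<Sum>n. \<Sum>A | A dvd Suc n. u (A, Suc n div A))" by simp
  also have "(\<Sum>n. \<Sum>A | A dvd Suc n. u (A, Suc n div A)) =
      (\<Sum>n. eisenstein_coeff chi1 chi2 k (Suc n) * expi (of_nat (Suc n) * z))"
  proof -
    have "u (A, N div A) = chi1 (int A) * cnj (chi2 (int (N div A))) * of_nat (N div A) ^ (k - 1) * expi (of_nat N * z)"
      if "A dvd N" for A N
      using expi_z[of A "N div A"] that by (simp add: u_def twist_def)
    then show ?thesis unfolding eisenstein_coeff_def sum_distrib_right by simp
  qed
  finally have "(\<lambda>n. (-1) ^ (k - 1) * g (Suc n) (k - 1) (2 * pi * real (Suc n) * t)) sums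
      (eisenstein chi1 chi2 k z / 2)"
    by (simp add: eisenstein_def)
  then have "(\<lambda>A. (-1) ^ (k - 1) * g A (k - 1) (2 * pi * real A * t)) sums (eisenstein chi1 chi2 k z / 2)"
    by (subst (asm) sums_Suc_iff) (simp add: g_row_0)
  from sums_mult[OF this, of "(-1) ^ (k - 1)"]
  have "(\<lambda>A. g A (k - 1) (2 * pi * real A * t)) sums ((-1) ^ (k - 1) * (eisenstein chi1 chi2 k z / 2))"
    by (simp add: mult.assoc[symmetric] power_mult_distrib[symmetric])
  note sums_unique[OF this, symmetric]
  moreover have "E = 2 * y * (y * (E / 2))" if "y * y = 1" for y E :: complex
  proof -
    have "2 * y * (y * (E / 2)) = (y * y) * E" by simp
    with that show ?thesis by simp
  qed
  ultimately show ?thesis unfolding z_def[symmetric]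
    by (simp only:) (simp add: power_mult_distrib[symmetric])
qed

end

section \<open>The period integral as a Dedekind sum\<close>

lemma expi_cong_diff:
  assumes "x - y \<in> \<int>" shows "expi (of_real x) = expi (of_real y)"
proof -
  obtain i where "x - y = of_int i" using assms by (auto elim: Ints_cases)
  then have "x = y + of_int i" by simp
  then have "complex_of_real x = of_real y + of_int i" by simp
  then show ?thesis by (simp only: expi_add_of_int)
qed

lemma periodic_bernoulli_1_minus: "periodic_bernoulli 1 (- y) = - periodic_bernoulli 1 y"
  by (auto simp: periodic_bernoulli_def bernoulli_poly_1[unfolded One_nat_def] frac_neg)

lemma periodic_bernoulli_add_int: "periodic_bernoulli m (y + of_int i) = periodic_bernoulli m y"
  by (simp add: periodic_bernoulli_def frac_def)

text \<open>At the integers both the periodic Bernoulli function and this function are 0 by convention.\<close>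
definition periodic_polylog :: "nat \<Rightarrow> real \<Rightarrow> complex" where
  "periodic_polylog m x = (if x \<in> \<int> then 0 else polylog_circle m (frac x))"

lemma periodic_polylog_add_int: "periodic_polylog m (x + of_int i) = periodic_polylog m x"
  by (simp add: periodic_polylog_def frac_def)

lemma periodic_polylog_fourier:
  assumes "m \<ge> 1"
  shows "periodic_polylog m x + (-1) ^ m * periodic_polylog m (- x) =
    - ((2 * of_real pi * \<i>) ^ m / fact m * of_real (periodic_bernoulli m x))"
proof (cases "x \<in> \<int>")
  case False
  have "frac x \<noteq> 0" using False frac_eq_0_iff by blast
  then have "0 < frac x" "frac x < 1" using frac_ge_0[of x] frac_lt_1[of x] by linarith+
  from bernoulli_poly_fourier[OF assms this] show ?thesis
    using False by (simp add: periodic_polylog_def periodic_bernoulli_def frac_neg)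
qed (simp add: periodic_polylog_def periodic_bernoulli_def)

lemma periodic_polylog_sums:
  assumes "m \<ge> 1" "x \<notin> \<int>"
  shows "(\<lambda>A. expi (of_nat A * of_real x) / of_nat A ^ m) sums periodic_polylog m x"
proof -
  have "frac x \<noteq> 0" using assms(2) frac_eq_0_iff by blast
  then have "0 < frac x" "frac x < 1" using frac_ge_0[of x] frac_lt_1[of x] by linarith+
  from polylog_circle_sums[OF assms(1) this]
  have "(\<lambda>A. expi (of_nat (Suc A) * of_real (frac x)) / of_nat (Suc A) ^ m) sums periodic_polylog m x"
    using assms(2) by (simp add: periodic_polylog_def)
  moreover have "expi (of_nat A * of_real (frac x)) = expi (of_nat A * of_real x)" for A
  proof -
    have "expi (of_real (real A * frac x)) = expi (of_real (real A * x))"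
      by (rule expi_cong_diff) (simp add: frac_def algebra_simps)
    then show ?thesis by simp
  qed
  ultimately have "(\<lambda>A. expi (of_nat (Suc A) * of_real x) / of_nat (Suc A) ^ m) sums periodic_polylog m x"
    by (simp only:)
  \<comment> \<open>The added term A = 0 is a division by \<open>0 ^ m\<close> with m \<ge> 1, hence
    0.\<close>
  then show ?thesis using assms(1) by (subst (asm) sums_Suc_iff) (auto simp: power_0_left)
qed

section \<open>Gauss sums and passage to Bernoulli functions\<close>

context eisenstein_cusp
begin

text \<open>For 0 < s < c the value of B_1 at s/c is s/c - 1/2. Mean zero removes the 1/2, and s = 0
  contributes nothing because the twist vanishes there.\<close>

lemma g_0_bernoulli:
  "g r 0 0 = - (\<Sum>s<c. twist r s * of_real (periodic_bernoulli 1 (real s / real c)))"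
proof -
  have "twist r s * of_real (periodic_bernoulli 1 (real s / real c)) =
      of_nat s * twist r s / of_nat c - twist r s / 2" if "s < c" for s
  proof (cases "s = 0")
    case False
    then have y: "0 < real s / real c" "real s / real c < 1" using that by auto
    then have "real s / real c \<notin> \<int>" by (auto elim!: Ints_cases)
    moreover have "frac (real s / real c) = real s / real c" using y by (simp add: frac_eq)
    ultimately have eq: "periodic_bernoulli 1 (real s / real c) = real s / real c - 1 / 2"
      by (simp add: periodic_bernoulli_def bernoulli_poly_1[unfolded One_nat_def])
    show ?thesis unfolding eq by (simp add: algebra_simps)
  qed (simp add: f_0_right)
  then have "(\<Sum>s<c. twist r s * of_real (periodic_bernoulli 1 (real s / real c))) =
      (\<Sum>s<c. of_nat s * twist r s / of_nat c - twist r s / 2)" by simp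
  also have "\<dots> = (\<Sum>s<c. of_nat s * twist r s) / of_nat c - (\<Sum>s<c. twist r s) / 2"
    by (simp add: sum_subtractf sum_divide_distrib)
  finally show ?thesis by (simp add: g_0 zero_mean2)
qed

text \<open>Not the argument of a complex number: the point at which B_(k-1) is evaluated in the
  claimed formula, with s for j and \<nu> for n. The other factors of that summand form
  \<open>weight\<close>.\<close>

definition arg :: "int \<Rightarrow> int \<Rightarrow> real" where
  "arg s \<nu> = of_int a * of_int s / real c + of_int \<nu> / real q1"

definition weight :: "int \<Rightarrow> int \<Rightarrow> complex" where
  "weight s \<nu> = cnj (chi1 \<nu>) * cnj (chi2 s) * of_real (periodic_bernoulli 1 (of_int s / real c))"

lemma arg_add: "arg (s + int c) \<nu> = arg s \<nu> + of_int a" "arg s (\<nu> + int q1) = arg s \<nu> + of_int 1"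
  using c_pos chi1(2) by (simp_all add: arg_def field_simps)

lemma weight_add: "weight (s + int c) \<nu> = weight s \<nu>" "weight s (\<nu> + int q1) = weight s \<nu>"
proof -
  have "of_int (s + int c) / real c = of_int s / real c + of_int 1" using c_pos by (simp add: field_simps)
  then show "weight (s + int c) \<nu> = weight s \<nu>"
    unfolding weight_def by (simp only: periodic_bernoulli_add_int chi_add_c)
  show "weight s (\<nu> + int q1) = weight s \<nu>"
    by (simp add: weight_def dirichlet_charD(3)[OF chi1(1)])
qed

text \<open>The leading minus sign is the oddness of B_1; multiplicativity of the characters
  supplies the rest.\<close>

lemma weight_minus:
  "weight (- s) (- \<nu>) = - cnj (chi1 (-1) * chi2 (-1)) * weight s \<nu>"
proof -
  have "chi1 (- \<nu>) = chi1 (-1) * chi1 \<nu>" using dirichlet_charD(2)[OF chi1(1), of "-1" \<nu>] by simp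
  moreover have "chi2 (- s) = chi2 (-1) * chi2 s" using dirichlet_charD(2)[OF chi2(1), of "-1" s] by simp
  moreover have "periodic_bernoulli 1 (of_int (- s) / real c) = - periodic_bernoulli 1 (of_int s / real c)"
    using periodic_bernoulli_1_minus[of "of_int s / real c"] by simp
  ultimately show ?thesis unfolding weight_def by simp
qed

text \<open>Clearing the denominator c in an integral value would make q2 divide a s, impossible
  when \<open>chi2 s\<close> is nonzero. So the series at these points converges even in order
  1.\<close>

lemma arg_notin_Ints:
  assumes "weight s \<nu> \<noteq> 0"
  shows "arg s \<nu> \<notin> \<int>"
proof
  assume "arg s \<nu> \<in> \<int>"
  then obtain i where "arg s \<nu> = of_int i" by (auto elim: Ints_cases)
  then have eq: "of_int a * of_int s / real c + of_int \<nu> / real q1 = of_int i" by (simp only: arg_def)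
  obtain l where l: "c = q1 * q2 * l" using level by (elim dvdE)
  then have real_c: "real c = real q1 * real q2 * real l" by simp
  have nz: "real q1 \<noteq> 0" "real q2 \<noteq> 0" "real l \<noteq> 0" using c_pos l by auto
  have "of_int a * of_int s + of_int \<nu> * real q2 * real l = of_int i * real q1 * real q2 * real l"
    using eq nz unfolding real_c by (simp add: field_simps)
  then have "of_int (a * s) = (of_int (int q2 * (i * int q1 * int l - \<nu> * int l)) :: real)"
    by (simp add: algebra_simps)
  then have "a * s = int q2 * (i * int q1 * int l - \<nu> * int l)" by (simp only: of_int_eq_iff)
  then have "int q2 dvd a * s" by simp
  moreover have "coprime a (int q2)" using coprime_ac q_dvd_c(2) by (meson coprime_divisors dvd_refl)
  ultimately have "int q2 dvd s" by (simp add: coprime_commute coprime_dvd_mult_right_iff)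
  moreover have "coprime s (int q2)"
    using assms dirichlet_charD(4)[OF chi2(1), of s] by (auto simp: weight_def)
  ultimately have "is_unit (int q2)" by (meson coprime_absorb_right)
  then show False using chi2(2) by simp
qed

text \<open>By \<open>gauss_sum_twist\<close> the Gauss sum times chi1(r) is a combination of the
  e(r \<nu> / q1), whose phases merge with that of the twist. As c times \<open>arg s \<nu>\<close>
  is an integer, r may be replaced by r + m c, and the residue sum becomes a block of one series
  over A.\<close>

lemma gauss_sum_times_block:
  assumes "primitive_dirichlet_char q1 chi1"
  shows "gauss_sum q1 (\<lambda>n. cnj (chi1 n)) * (\<Sum>r<c. g r 0 0 / of_nat (r + m * c) ^ l) =
    - (\<Sum>s\<in>{0..<int c}. \<Sum>\<nu>\<in>{0..<int q1}. weight s \<nu> *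
        (\<Sum>A\<in>{m * c..<m * c + c}. expi (of_nat A * of_real (arg s \<nu>)) / of_nat A ^ l))"
proof -
  have "gauss_sum q1 (\<lambda>n. cnj (chi1 n)) * twist r s * of_real (periodic_bernoulli 1 (real s / real c)) =
      (\<Sum>\<nu>\<in>{0..<int q1}. weight (int s) \<nu> * expi (of_nat (r + m * c) * of_real (arg (int s) \<nu>)))" for r s
  proof -
    have e: "expi (of_int (int r * \<nu>) / of_nat q1) * expi (of_int (a * int r * int s) / of_nat c) =
        expi (of_nat (r + m * c) * of_real (arg (int s) \<nu>))" for \<nu>
    proof -
      obtain l where l: "c = q1 * q2 * l" using level by (auto elim!: dvdE)
      have "of_nat (r + m * c) * of_real (arg (int s) \<nu>) =
          of_int (int r * \<nu>) / of_nat q1 + of_int (a * int r * int s) / of_nat c +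
          (of_int (int m * a * int s + int m * \<nu> * int q2 * int l) :: complex)"
      proof -
        have "c * m * \<nu> / q1 = m * \<nu> * q2 * l" using chi1(2) by (simp add: l)
        then have "real (r + m * c) * arg (int s) \<nu> =
            of_int (int r * \<nu>) / real q1 + of_int (a * int r * int s) / real c +
            of_int (int m * a * int s + int m * \<nu> * int q2 * int l)"
          using c_pos chi1(2) by (simp add: arg_def distrib_left distrib_right) (simp add: field_simps)
        then have "complex_of_real (real (r + m * c) * arg (int s) \<nu>) =
            complex_of_real (of_int (int r * \<nu>) / real q1 + of_int (a * int r * int s) / real c +
            of_int (int m * a * int s + int m * \<nu> * int q2 * int l))" by (simp only:)
        then show ?thesis by simp
      qed
      then show ?thesis by (simp only: expi_add_of_int expi_add[symmetric])
    qed
    have eq: "gauss_sum q1 (\<lambda>n. cnj (chi1 n)) * twist r s =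
        (\<Sum>\<nu>\<in>{0..<int q1}. cnj (chi1 \<nu>) * expi (of_int (int r * \<nu>) / of_nat q1)) *
        (cnj (chi2 (int s)) * expi (of_int (a * int r * int s) / of_nat c))"
      unfolding gauss_sum_twist[OF assms] twist_def by (simp only: mult_ac)
    show ?thesis
      unfolding eq sum_distrib_right weight_def e[symmetric] of_int_of_nat_eq by (simp only: mult_ac)
  qed
  note twist = this
  have "gauss_sum q1 (\<lambda>n. cnj (chi1 n)) * (\<Sum>r<c. g r 0 0 / of_nat (r + m * c) ^ l) =
      - (\<Sum>r<c. \<Sum>s<c. gauss_sum q1 (\<lambda>n. cnj (chi1 n)) * twist r s *
          of_real (periodic_bernoulli 1 (real s / real c)) / of_nat (r + m * c) ^ l)"
    by (simp add: g_0_bernoulli sum_distrib_left sum_divide_distrib sum_negf mult.assoc)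
  also have "(\<Sum>r<c. \<Sum>s<c. gauss_sum q1 (\<lambda>n. cnj (chi1 n)) * twist r s *
          of_real (periodic_bernoulli 1 (real s / real c)) / of_nat (r + m * c) ^ l) =
      (\<Sum>r<c. \<Sum>s<c. \<Sum>\<nu>\<in>{0..<int q1}. weight (int s) \<nu> *
          (expi (of_nat (r + m * c) * of_real (arg (int s) \<nu>)) / of_nat (r + m * c) ^ l))"
    unfolding twist by (simp only: sum_divide_distrib times_divide_eq_right)
  also have "\<dots> = (\<Sum>s<c. \<Sum>r<c. \<Sum>\<nu>\<in>{0..<int q1}. weight (int s) \<nu> *
          (expi (of_nat (r + m * c) * of_real (arg (int s) \<nu>)) / of_nat (r + m * c) ^ l))"
    by (rule sum.swap)
  also have "\<dots> = (\<Sum>s<c. \<Sum>\<nu>\<in>{0..<int q1}. \<Sum>r<c. weight (int s) \<nu> *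
          (expi (of_nat (r + m * c) * of_real (arg (int s) \<nu>)) / of_nat (r + m * c) ^ l))"
    by (intro sum.cong refl sum.swap)
  also have "\<dots> = (\<Sum>s<c. \<Sum>\<nu>\<in>{0..<int q1}. weight (int s) \<nu> *
        (\<Sum>A\<in>{m * c..<m * c + c}. expi (of_nat A * of_real (arg (int s) \<nu>)) / of_nat A ^ l))"
  proof (intro sum.cong refl)
    fix s \<nu>
    have "(\<Sum>A\<in>{m * c..<m * c + c}. expi (of_nat A * of_real (arg (int s) \<nu>)) / of_nat A ^ l) =
        (\<Sum>r<c. expi (of_nat (r + m * c) * of_real (arg (int s) \<nu>)) / of_nat (r + m * c) ^ l)"
      using sum.shift_bounds_nat_ivl[of "\<lambda>A. expi (of_nat A * of_real (arg (int s) \<nu>)) / of_nat A ^ l" 0 "m * c" c]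
      by (simp only: lessThan_atLeast0 add_0 add.commute[of c])
    then show "(\<Sum>r<c. weight (int s) \<nu> *
          (expi (of_nat (r + m * c) * of_real (arg (int s) \<nu>)) / of_nat (r + m * c) ^ l)) =
        weight (int s) \<nu> * (\<Sum>A\<in>{m * c..<m * c + c}. expi (of_nat A * of_real (arg (int s) \<nu>)) / of_nat A ^ l)"
      by (simp only: sum_distrib_left)
  qed
  finally show ?thesis by (simp only: sum_int_lessThan)
qed

text \<open>Only finitely many pairs (s, \<nu>) occur, so convergence is checked for each. Pairs of
  weight 0 are set aside because the series may diverge there.\<close>

lemma gauss_sum_times_series:
  assumes "primitive_dirichlet_char q1 chi1" and "l \<ge> 1"
  shows "(\<lambda>m. gauss_sum q1 (\<lambda>n. cnj (chi1 n)) * (\<Sum>r<c. g r 0 0 / of_nat (r + m * c) ^ l)) sums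
    - (\<Sum>s\<in>{0..<int c}. \<Sum>\<nu>\<in>{0..<int q1}. weight s \<nu> * periodic_polylog l (arg s \<nu>))"
  unfolding gauss_sum_times_block[OF assms(1)]
proof (intro sums_minus sums_sum)
  fix s \<nu>
  show "(\<lambda>m. weight s \<nu> * (\<Sum>A\<in>{m * c..<m * c + c}. expi (of_nat A * of_real (arg s \<nu>)) / of_nat A ^ l)) sums
    (weight s \<nu> * periodic_polylog l (arg s \<nu>))"
  proof (cases "weight s \<nu> = 0")
    case False
    then show ?thesis
      using sums_group[OF periodic_polylog_sums[OF assms(2) arg_notin_Ints] c_pos] by (intro sums_mult) auto
  qed simp
qed

text \<open>The summand changes by the sign \<open>(- 1) ^ l\<close> under \<open>(s, \<nu>) \<mapsto> (- s, - \<nu>)\<close>, which turns the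
  one-sided series into the Fourier series of the periodic Bernoulli function.\<close>
lemma weighted_polylog_sum:
  assumes "chi1 (-1) * chi2 (-1) = (-1) ^ Suc l" and "l \<ge> 1"
  shows "2 * (\<Sum>s\<in>{0..<int c}. \<Sum>\<nu>\<in>{0..<int q1}. weight s \<nu> * periodic_polylog l (arg s \<nu>)) =
    - ((2 * of_real pi * \<i>) ^ l / fact l) *
      (\<Sum>s\<in>{0..<int c}. \<Sum>\<nu>\<in>{0..<int q1}. weight s \<nu> * of_real (periodic_bernoulli l (arg s \<nu>)))"
proof -
  define h where "h = (\<lambda>s \<nu>. weight s \<nu> * periodic_polylog l (arg s \<nu>))"
  have per: "h (s + int c) \<nu> = h s \<nu>" "h s (\<nu> + int q1) = h s \<nu>" for s \<nu>
    unfolding h_def weight_add arg_add periodic_polylog_add_int by (rule refl)+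
  have "(\<Sum>s\<in>{0..<int c}. sum (h s) {0..<int q1}) = (\<Sum>s\<in>{0..<int c}. \<Sum>\<nu>\<in>{0..<int q1}. h s (- \<nu>))"
    using per(2) chi1(2) by (intro sum.cong refl sum_residues_uminus[symmetric]) auto
  also have "\<dots> = (\<Sum>s\<in>{0..<int c}. \<Sum>\<nu>\<in>{0..<int q1}. h (- s) (- \<nu>))"
    using sum_residues_uminus[of "\<lambda>s. \<Sum>\<nu>\<in>{0..<int q1}. h s (- \<nu>)" "int c"] per(1) c_pos by simp
  also have "\<dots> = (\<Sum>s\<in>{0..<int c}. \<Sum>\<nu>\<in>{0..<int q1}. weight s \<nu> * ((-1) ^ l * periodic_polylog l (- arg s \<nu>)))"
  proof (intro sum.cong refl)
    fix s \<nu>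
    have "arg (- s) (- \<nu>) = - arg s \<nu>" by (simp add: arg_def)
    moreover have "- cnj (chi1 (-1) * chi2 (-1)) = (-1) ^ l" unfolding assms(1) by simp
    ultimately show "h (- s) (- \<nu>) = weight s \<nu> * ((-1) ^ l * periodic_polylog l (- arg s \<nu>))"
      unfolding h_def weight_minus by (simp only: mult_ac)
  qed
  finally have "2 * (\<Sum>s\<in>{0..<int c}. sum (h s) {0..<int q1}) =
      (\<Sum>s\<in>{0..<int c}. sum (h s) {0..<int q1}) +
      (\<Sum>s\<in>{0..<int c}. \<Sum>\<nu>\<in>{0..<int q1}. weight s \<nu> * ((-1) ^ l * periodic_polylog l (- arg s \<nu>)))"
    by (simp only: mult_2)
  also have "\<dots> = (\<Sum>s\<in>{0..<int c}. \<Sum>\<nu>\<in>{0..<int q1}. weight s \<nu> *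
      (periodic_polylog l (arg s \<nu>) + (-1) ^ l * periodic_polylog l (- arg s \<nu>)))"
    by (simp only: h_def sum.distrib distrib_left)
  also have "\<dots> = - ((2 * of_real pi * \<i>) ^ l / fact l) *
      (\<Sum>s\<in>{0..<int c}. \<Sum>\<nu>\<in>{0..<int q1}. weight s \<nu> * of_real (periodic_bernoulli l (arg s \<nu>)))"
    unfolding periodic_polylog_fourier[OF assms(2)] sum_distrib_left by (simp add: mult_ac)
  finally show ?thesis unfolding h_def .
qed

text \<open>What remains is the balance of constants. With n = k - 2 the moment gives n! / (2
  pi)^(n+1), the Fourier expansion gives (2 pi i)^(n+1) / (n+1)!, the definition of S gives n + 1,
  and the signs and powers of i multiply to 1.\<close>

theorem S_sum_eq:
  assumes "k \<ge> 2" and "primitive_dirichlet_char q1 chi1" and "chi1 (-1) * chi2 (-1) = (-1) ^ k"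
  shows "S_sum q1 chi1 chi2 k a b (int c) d =
    (\<Sum>s\<in>{0..<int c}. \<Sum>\<nu>\<in>{0..<int q1}. weight s \<nu> * of_real (periodic_bernoulli (k - 1) (arg s \<nu>)))"
proof -
  obtain n where k: "k = Suc (Suc n)" using assms(1) by (metis add_2_eq_Suc le_Suc_ex)
  let ?\<tau> = "gauss_sum q1 (\<lambda>n. cnj (chi1 n))"
  let ?B = "\<Sum>s\<in>{0..<int c}. \<Sum>\<nu>\<in>{0..<int q1}. weight s \<nu> * of_real (periodic_bernoulli (Suc n) (arg s \<nu>))"
  define T where "T = (\<Sum>s\<in>{0..<int c}. \<Sum>\<nu>\<in>{0..<int q1}. weight s \<nu> * periodic_polylog (Suc n) (arg s \<nu>))"
  define F where "F = (\<lambda>t. \<Sum>A. of_real t ^ n * g A (Suc n) (2 * pi * real A * t))"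
  define C where "C = ((-1) ^ Suc n * fact n / (2 * of_real pi) ^ Suc n :: complex)"
  have "(\<lambda>m. \<Sum>r<c. (-1) ^ Suc n * fact n / (2 * of_real pi * of_nat (r + m * c)) ^ Suc n * g r 0 0)
      sums integral {0<..} F"
    by (rule moment_integral_sums) (simp add: F_def)
  then have "(\<lambda>m. ?\<tau> * (\<Sum>r<c. (-1) ^ Suc n * fact n / (2 * of_real pi * of_nat (r + m * c)) ^ Suc n * g r 0 0))
      sums (?\<tau> * integral {0<..} F)" by (rule sums_mult)
  moreover have "?\<tau> * (\<Sum>r<c. (-1) ^ Suc n * fact n / (2 * of_real pi * of_nat (r + m * c)) ^ Suc n * g r 0 0) =
      C * (?\<tau> * (\<Sum>r<c. g r 0 0 / of_nat (r + m * c) ^ Suc n))" for m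
    unfolding C_def sum_distrib_left
    by (intro sum.cong refl) (simp only: power_mult_distrib times_divide_eq_right times_divide_eq_left mult_ac divide_divide_eq_left)
  moreover have "(\<lambda>m. C * (?\<tau> * (\<Sum>r<c. g r 0 0 / of_nat (r + m * c) ^ Suc n))) sums (C * (- T))"
    unfolding T_def by (intro sums_mult gauss_sum_times_series assms(2)) simp
  ultimately have \<tau>_integral: "?\<tau> * integral {0<..} F = C * (- T)" by (simp only: sums_unique2)
  have T: "2 * T = - ((2 * of_real pi * \<i>) ^ Suc n / fact (Suc n)) * ?B"
    unfolding T_def using assms(3) by (intro weighted_polylog_sum) (simp_all add: k)
  \<comment> \<open>On the vertical line the polynomial at (1, - a/c) is (i t)^n, whence the factor
    i^n.\<close>
  have "integral {0<..} (\<lambda>t::real. eisenstein chi1 chi2 k (of_int a / of_nat c + \<i> * of_real t) *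
      (1 * (of_int a / of_nat c + \<i> * of_real t) + (- (of_int a / of_nat c))) ^ (k - 2)) =
      integral {0<..} (\<lambda>t. (2 * (-1) ^ Suc n * \<i> ^ n) * F t)"
  proof (rule integral_cong)
    fix t :: real assume "t \<in> {0<..}"
    then have t: "t > 0" by simp
    have sm: "summable (\<lambda>A. of_real t ^ n * g A (Suc n) (2 * pi * real A * t))"
      by (rule summable_norm_cancel[OF summable_norm_terms[OF t]])
    have "F t = of_real t ^ n * (\<Sum>A. g A (Suc n) (2 * pi * real A * t))"
      unfolding F_def using t sm by (intro suminf_mult) simp
    then show "eisenstein chi1 chi2 k (of_int a / of_nat c + \<i> * of_real t) *
      (1 * (of_int a / of_nat c + \<i> * of_real t) + (- (of_int a / of_nat c))) ^ (k - 2) =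
      (2 * (-1) ^ Suc n * \<i> ^ n) * F t"
      unfolding eisenstein_eq_suminf_g[OF t] by (simp add: k power_mult_distrib mult_ac)
  qed
  also have "\<dots> = (2 * (-1) ^ Suc n * \<i> ^ n) * integral {0<..} F"
    by (rule integral_mult_right)
  finally have period: "period_integral chi1 chi2 k a b (int c) d 1 (- (of_int a / of_int (int c))) =
      - \<i> * ((2 * (-1) ^ Suc n * \<i> ^ n) * integral {0<..} F)"
    by (simp only: period_integral_def of_int_of_nat_eq)
  have "S_sum q1 chi1 chi2 k a b (int c) d =
      (-1) ^ k * of_nat (Suc n) * (- \<i>) * (-1) ^ Suc n * \<i> ^ n * (2 * (?\<tau> * integral {0<..} F))"
    unfolding S_sum_def period by (simp only: k diff_Suc_1 mult_ac)
  \<comment> \<open>The factor 2 in the normalisation of the Eisenstein series is exactly what the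
    symmetrization of \<open>T\<close> requires.\<close>
  also have "2 * (?\<tau> * integral {0<..} F) = C * - (2 * T)" unfolding \<tau>_integral by simp
  also have "(-1) ^ k * of_nat (Suc n) * (- \<i>) * (-1) ^ Suc n * \<i> ^ n * (C * - (2 * T)) =
      ((-1) ^ k * (- \<i>) * (-1) ^ Suc n * (-1) ^ Suc n * (\<i> ^ n * \<i> ^ Suc n)) *
      (of_nat (Suc n) * fact n / fact (Suc n)) * ((2 * of_real pi) ^ Suc n / (2 * of_real pi) ^ Suc n) * ?B"
  proof -
    have "e * N * x * s * y * (s * f1 / p * - (- (p * z / f2) * B)) =
        (e * x * s * s * (y * z)) * (N * f1 / f2) * (p / p) * B" for e N x s y f1 p z f2 B :: complex
      by (simp add: divide_inverse mult_ac)
    then show ?thesis unfolding T C_def power_mult_distrib[of "2 * of_real pi" \<i>] .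
  qed
  also have "(2 * of_real pi) ^ Suc n / (2 * of_real pi) ^ Suc n = (1 :: complex)" by simp
  also have "of_nat (Suc n) * fact n / fact (Suc n) = (1 :: complex)"
    unfolding fact_Suc using of_nat_neq_0[of n, where 'a = complex] by (simp del: of_nat_Suc)
  also have "(-1) ^ k * (- \<i>) * (-1) ^ Suc n * (-1) ^ Suc n * (\<i> ^ n * \<i> ^ Suc n) = 1"
  proof -
    have "\<i> ^ n * \<i> ^ Suc n = \<i> * (-1) ^ n"
      by (simp add: power_mult_distrib[symmetric])
    moreover have "(-1) ^ n * (-1) ^ n = (1 :: complex)" by (simp add: power_mult_distrib[symmetric])
    ultimately show ?thesis by (simp add: k mult_ac)
  qed
  finally show ?thesis by (simp add: k)
qed

end

theorem theorem1p7:
  fixes k q1 q2 :: nat and chi1 chi2 :: "int \<Rightarrow> complex" and a b c d :: int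
  assumes "k \<ge> 2"
    and "primitive_dirichlet_char q1 chi1" and "nontrivial_dirichlet_char q1 chi1"
    and "primitive_dirichlet_char q2 chi2" and "nontrivial_dirichlet_char q2 chi2"
    and "chi1 (-1) * chi2 (-1) = (-1) ^ k"
    and "a * d - b * c = 1" and "int (q1 * q2) dvd c"
    and "c > 0"
  shows "S_sum q1 chi1 chi2 k a b c d =
    (\<Sum>j\<in>{0..<c}. \<Sum>n\<in>{0..<int q1}.
       cnj (chi1 n) * cnj (chi2 j) *
       of_real (periodic_bernoulli 1 (real_of_int j / real_of_int c)) *
       of_real (periodic_bernoulli (k - 1)
                  (real_of_int a * real_of_int j / real_of_int c + real_of_int n / real q1)))"
proof -
  have c: "int (nat c) = c" using assms(9) by simp
  have dc: "dirichlet_char q1 chi1" "dirichlet_char q2 chi2"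
    using assms(2,4) by (auto simp: primitive_dirichlet_char_def)
  \<comment> \<open>Determinant 1 makes a and c coprime, and non-triviality gives moduli above
    1.\<close>
  interpret eisenstein_cusp q1 q2 chi1 chi2 a "nat c"
  proof
    show "coprime a (int (nat c))"
    proof (rule coprimeI)
      fix e assume "e dvd a" "e dvd int (nat c)"
      then have "e dvd a * d - b * c" unfolding c by (intro dvd_diff dvd_mult dvd_mult2)
      then show "is_unit e" by (simp only: assms(7))
    qed
    show "q1 * q2 dvd nat c" using assms(8) by (simp only: c flip: int_dvd_int_iff)
    show "q1 > 1" "q2 > 1" using dc assms(3,5) by (auto dest: nontrivial_dirichlet_char_modulus)
  qed (use dc assms(9) in auto)
  have "real (nat c) = real_of_int c" using assms(9) by simp
  then show ?thesis
    using S_sum_eq[OF assms(1,2,6)] unfolding c weight_def arg_def by (simp only:)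
qed

end
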